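(* Let $G=SU(2)$ in its defining representation, so that the matrix size is $N=2$, $\mathfrak g=\mathfrak{su}(2)$, and $g_{\alpha\beta}=\operatorname{Tr}(e_\alpha e_\beta)$ is computed in the defining representation. Let $\lambda\in\mathbb C\setminus\{0\}$ and $\beta=\frac1{2\lambda}$. Let $C_1,\dots,C_m$ be an oriented link in general position with double points $x_1,\dots,x_k$, let $i\in\{1,\dots,k\}$ and $S\subset\{1,\dots,k\}\setminus\{i\}$. With the reconnected Wilson loop functions $W_S$, the operators $D_1,\dots,D_k$ and the signs $\epsilon_j$ defined in the context, put $Q=\prod_{j\ne i}e^{\beta D_j}$. Then: If $\epsilon_i=+1$ (overcrossing), $$e^{\beta D_i}\,Q\,W_S=\Big(\cosh(\sqrt3\,\beta)-\tfrac1{\sqrt3}\sinh(\sqrt3\,\beta)\Big)\,Q\,W_S+\tfrac{2}{\sqrt3}\sinh(\sqrt3\,\beta)\;Q\,W_{S\cup\{i\}} .$$ If $\epsilon_i=-1$ (undercrossing), $$e^{\beta D_i}\,Q\,W_S=\Big(\cosh(\sqrt3\,\beta)+\tfrac1{\sqrt3}\sinh(\sqrt3\,\beta)\Big)\,Q\,W_S-\tfrac{2}{\sqrt3}\sinh(\sqrt3\,\beta)\;Q\,W_{S\cup\{i\}} .$$ In particular (case $S=\emptyset$) the left-hand side is the expectation $\langle W_{C_1}\cdots W_{C_m}\rangle$ of the product of Wilson loops, as a function of the background connection.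
   Context: Link in general position. $C_1,\dots,C_m$ are pairwise disjoint oriented smooth simple closed curves in $\mathbb R^3=\mathbb R^2\times\mathbb R$ whose projections to $\mathbb R^2$ are immersed curves whose only multiple points are finitely many transverse double points $x_1,\dots,x_k$. Over $x_i$ lie two points $p_i^{+}=(x_i,t_i^{+})$ and $p_i^-=(x_i,t_i^-)$ of the link, labelled so that (projected tangent of the strand through $p_i^+$, projected tangent of the strand through $p_i^-$) is a positively oriented basis of $\mathbb R^2$. Put $\epsilon_i=\operatorname{sgn}(t_i^+-t_i^-)$; the crossing is an overcrossing if $\epsilon_i=+1$ and an undercrossing if $\epsilon_i=-1$. Let $u(s)=\frac12$ for $s\ge0$ and $u(s)=-\frac12$ for $s<0$, so $u(t_i^+-t_i^-)=\frac12\epsilon_i$. Arcs. Removing the $2k$ points $p_i^\pm$ cuts the link into oriented arcs (a component containing none of these points counts as one closed arc). For each removed point $p$ let $\mathrm{in}(p)$ be the arc ending at $p$ and $\mathrm{out}(p)$ the arc starting at $p$ (possibly equal). To each arc $a$ assign an independent $N\times N$ complex matrix variable $h_a$, and let $\mathcal P$ be the algebra of complex polynomial functions on $\prod_a M_N(\mathbb C)$. A background connection $A$ (a $\mathfrak g$-valued one-form with vanishing third component) enters by evaluating $h_a$ at the holonomy of $A$ along $a$; holonomies are multiplied left to right in order of traversal. Reconnected Wilson loop functions. For $S\subset\{1,\dots,k\}$, follow $\mathrm{in}(p_j^\pm)$ by $\mathrm{out}(p_j^\pm)$ if $j\notin S$, and by $\mathrm{out}(p_j^\mp)$ if $j\in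 S$ (oriented smoothing with a jump). This partitions the arcs into closed cyclic sequences $(a_1,\dots,a_r)$, and $W_S\in\mathcal P$ is the product over these sequences of $\operatorname{tr}(h_{a_1}\cdots h_{a_r})$. Thus $W_\emptyset=W_{C_1}\cdots W_{C_m}$, where $W_C(A)=\operatorname{tr}\operatorname{hol}_C(A)$. Operators. Let $\{e_\alpha\}$ be a basis of $\mathfrak g\subset M_N(\mathbb C)$ and $g_{\alpha\beta}=\operatorname{Tr}(e_\alpha e_\beta)$. For a removed point $p$, $\frac{\delta}{\delta A_\alpha(p)}$ is the derivation of $\mathcal P$ with $h_{\mathrm{in}(p)}\mapsto\frac12 h_{\mathrm{in}(p)}e_\alpha$, $h_{\mathrm{out}(p)}\mapsto\frac12 e_\alpha h_{\mathrm{out}(p)}$ (the sum of both if $\mathrm{in}(p)=\mathrm{out}(p)$), and all other $h_a\mapsto0$. Then $$D_i=4\,u(t_i^+-t_i^-)\sum_{\alpha,\beta}(g^{-1})_{\alpha\beta}\frac{\delta}{\delta A_\alpha(p_i^+)}\frac{\delta}{\delta A_\beta(p_i^-)} .$$ The $D_i$ commute and preserve polynomial degree, so $e^{\beta D_i}$ is well defined on $\mathcal P$. The expectation is $\langle W_{C_1}\cdots W_{C_m}\rangle=\prod_{i=1}^k e^{\frac1{2\lambda}D_i}\,W_\emptyset$. *)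

theory Defs
  imports "HOL-Analysis.Analysis" "HOL-Combinatorics.Orbits"
begin

text \<open>A link is given by closed curves \<open>curve L j\<close> (\<open>1 \<le> j \<le> ncomp L\<close>), each a 1-periodic
  function of a real parameter, together with an enumeration \<open>dpoint L i\<close>
  (\<open>1 \<le> i \<le> ncross L\<close>) of the double points of the projection. A point of the link is described
  by a pair (component, parameter in \<open>[0,1)\<close>); \<open>cpt L i True\<close> and \<open>cpt L i False\<close> describe
  \<open>p\<^sub>i\<^sup>+\<close> and \<open>p\<^sub>i\<^sup>-\<close>.\<close>

record link =
  ncomp :: nat
  curve :: "nat \<Rightarrow> real \<Rightarrow> real^3"
  ncross :: nat
  dpoint :: "nat \<Rightarrow> real^2"
  cpt :: "nat \<Rightarrow> bool \<Rightarrow> nat \<times> real"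

definition proj :: "real^3 \<Rightarrow> real^2" where
  "proj v = vector [v $ 1, v $ 2]"

definition params :: "link \<Rightarrow> (nat \<times> real) set" where
  "params L = {1..ncomp L} \<times> {0..<1}"

definition point_at :: "link \<Rightarrow> nat \<times> real \<Rightarrow> real^3" where
  "point_at L q = curve L (fst q) (snd q)"

definition proj_tangent :: "link \<Rightarrow> nat \<times> real \<Rightarrow> real^2" where
  "proj_tangent L q = proj (vector_derivative (curve L (fst q)) (at (snd q)))"

definition fibre :: "link \<Rightarrow> real^2 \<Rightarrow> (nat \<times> real) set" where
  "fibre L y = {q \<in> params L. proj (point_at L q) = y}"

definition smooth_curve :: "(real \<Rightarrow> real^3) \<Rightarrow> bool" where
  "smooth_curve \<gamma> \<longleftrightarrow>
     (\<exists>D :: nat \<Rightarrow> real \<Rightarrow> real^3. D 0 = \<gamma> \<and>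
        (\<forall>n s. (D n has_vector_derivative D (Suc n) s) (at s)))"

definition smooth_link :: "link \<Rightarrow> bool" where
  "smooth_link L \<longleftrightarrow>
     (\<forall>j\<in>{1..ncomp L}. smooth_curve (curve L j) \<and> (\<forall>s. curve L j (s + 1) = curve L j s)) \<and>
     inj_on (point_at L) (params L)"

definition generic_projection :: "link \<Rightarrow> bool" where
  "generic_projection L \<longleftrightarrow>
     (\<forall>q\<in>params L. proj_tangent L q \<noteq> 0) \<and>
     (\<forall>y. finite (fibre L y) \<and> card (fibre L y) \<le> 2) \<and>
     finite {y. card (fibre L y) = 2} \<and>
     (\<forall>q\<in>params L. \<forall>q'\<in>params L.
        q \<noteq> q' \<and> proj (point_at L q) = proj (point_at L q') \<longrightarrow>
          det (vector [proj_tangent L q, proj_tangent L q']) \<noteq> 0)"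

definition labelled_double_points :: "link \<Rightarrow> bool" where
  "labelled_double_points L \<longleftrightarrow>
     bij_betw (dpoint L) {1..ncross L} {y. card (fibre L y) = 2} \<and>
     (\<forall>i\<in>{1..ncross L}.
        fibre L (dpoint L i) = {cpt L i True, cpt L i False} \<and>
        det (vector [proj_tangent L (cpt L i True), proj_tangent L (cpt L i False)]) > 0)"

definition link_in_general_position :: "link \<Rightarrow> bool" where
  "link_in_general_position L \<longleftrightarrow>
     smooth_link L \<and> generic_projection L \<and> labelled_double_points L"

text \<open>\<open>height_diff L i\<close> is \<open>t\<^sub>i\<^sup>+ - t\<^sub>i\<^sup>-\<close>.\<close>

definition height_diff :: "link \<Rightarrow> nat \<Rightarrow> real" where
  "height_diff L i = point_at L (cpt L i True) $ 3 - point_at L (cpt L i False) $ 3"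

definition crossing_sign :: "link \<Rightarrow> nat \<Rightarrow> real" where
  "crossing_sign L i = sgn (height_diff L i)"

definition step :: "real \<Rightarrow> real" where
  "step s = (if s \<ge> 0 then 1/2 else - 1/2)"

definition removed_points :: "link \<Rightarrow> (real^3) set" where
  "removed_points L = {point_at L (cpt L i b) | i b. i \<in> {1..ncross L}}"

definition arcs :: "link \<Rightarrow> (real^3) set set" where
  "arcs L = components ((\<Union>j\<in>{1..ncomp L}. range (curve L j)) - removed_points L)"

text \<open>The arc ending (starting) at a removed point is the one that contains the strand
  immediately before (after) that point.\<close>

definition in_arc :: "link \<Rightarrow> nat \<Rightarrow> bool \<Rightarrow> (real^3) set" where
  "in_arc L i b = (THE a. a \<in> arcs L \<and>
     (\<forall>\<^sub>F s in at_left (snd (cpt L i b)). curve L (fst (cpt L i b)) s \<in> a))"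

definition out_arc :: "link \<Rightarrow> nat \<Rightarrow> bool \<Rightarrow> (real^3) set" where
  "out_arc L i b = (THE a. a \<in> arcs L \<and>
     (\<forall>\<^sub>F s in at_right (snd (cpt L i b)). curve L (fst (cpt L i b)) s \<in> a))"

text \<open>An assignment \<open>h\<close> of matrices to arcs is a total function; only its values on
  \<open>arcs L\<close> matter for the elements of \<open>poly_functions (arcs L)\<close>. Note that \<open>*\<close> on
  \<open>complex^'n^'n\<close> is componentwise; the matrix product is \<open>**\<close>.\<close>

type_synonym 'n assignment = "(real^3) set \<Rightarrow> complex^'n^'n"
type_synonym 'n arc_function = "'n assignment \<Rightarrow> complex"

inductive_set poly_functions :: "(real^3) set set \<Rightarrow> ('n::finite) arc_function set"
  for X :: "(real^3) set set" where
  const: "(\<lambda>h. c) \<in> poly_functions X"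
| entry: "a \<in> X \<Longrightarrow> (\<lambda>h. h a $ r $ s) \<in> poly_functions X"
| add: "F \<in> poly_functions X \<Longrightarrow> G \<in> poly_functions X \<Longrightarrow> (\<lambda>h. F h + G h) \<in> poly_functions X"
| mult: "F \<in> poly_functions X \<Longrightarrow> G \<in> poly_functions X \<Longrightarrow> (\<lambda>h. F h * G h) \<in> poly_functions X"

definition derivation_on ::
    "('n::finite) arc_function set \<Rightarrow> ('n arc_function \<Rightarrow> 'n arc_function) \<Rightarrow> bool" where
  "derivation_on P d \<longleftrightarrow>
     (\<forall>F\<in>P. d F \<in> P) \<and>
     (\<forall>F\<in>P. \<forall>G\<in>P. d (\<lambda>h. F h + G h) = (\<lambda>h. d F h + d G h)) \<and>
     (\<forall>c. \<forall>F\<in>P. d (\<lambda>h. c * F h) = (\<lambda>h. c * d F h)) \<and>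
     (\<forall>F\<in>P. \<forall>G\<in>P. d (\<lambda>h. F h * G h) = (\<lambda>h. d F h * G h + F h * d G h))"

text \<open>\<open>insertion L i b X\<close> is the functional derivative at \<open>p\<^sub>i\<^sup>+\<close> (\<open>b = True\<close>) or \<open>p\<^sub>i\<^sup>-\<close>
  (\<open>b = False\<close>) in the direction \<open>X\<close>. It is prescribed on each matrix entry of each arc
  variable.\<close>

definition insertion ::
    "link \<Rightarrow> nat \<Rightarrow> bool \<Rightarrow> complex^'n^'n \<Rightarrow> ('n::finite) arc_function \<Rightarrow> 'n arc_function" where
  "insertion L i b X =
     (THE d. d \<in> extensional (poly_functions (arcs L)) \<and>
        derivation_on (poly_functions (arcs L)) d \<and>
        (\<forall>a\<in>arcs L. \<forall>r s. d (\<lambda>h. h a $ r $ s) =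
           (\<lambda>h. (if a = in_arc L i b then (1/2) * (h a ** X) $ r $ s else 0) +
                (if a = out_arc L i b then (1/2) * (X ** h a) $ r $ s else 0))))"

definition gram :: "('b::finite \<Rightarrow> complex^'n^'n) \<Rightarrow> complex^'b^'b" where
  "gram e = (\<chi> \<alpha> \<beta>. trace (e \<alpha> ** e \<beta>))"

definition crossing_op ::
    "link \<Rightarrow> ('b::finite \<Rightarrow> complex^'n^'n) \<Rightarrow> nat \<Rightarrow> ('n::finite) arc_function \<Rightarrow> 'n arc_function" where
  "crossing_op L e i F =
     (\<lambda>h. 4 * complex_of_real (step (height_diff L i)) *
        (\<Sum>\<alpha>\<in>UNIV. \<Sum>\<beta>\<in>UNIV. matrix_inv (gram e) $ \<alpha> $ \<beta> *
           insertion L i True (e \<alpha>) (insertion L i False (e \<beta>) F) h))"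

text \<open>The crossing operators preserve the degree, so on a polynomial function the exponential
  series stays in a finite-dimensional space, where convergence is pointwise convergence.\<close>

definition exp_op ::
    "complex \<Rightarrow> ('n arc_function \<Rightarrow> 'n arc_function) \<Rightarrow> ('n::finite) arc_function \<Rightarrow> 'n arc_function" where
  "exp_op \<beta> D F = (\<lambda>h. \<Sum>n. \<beta> ^ n / fact n * (D ^^ n) F h)"

text \<open>The crossing operators commute on polynomial functions, so the order in the list is
  immaterial.\<close>

definition exp_prod ::
    "link \<Rightarrow> ('b::finite \<Rightarrow> complex^'n^'n) \<Rightarrow> complex \<Rightarrow> nat list \<Rightarrow>
       ('n::finite) arc_function \<Rightarrow> 'n arc_function" where
  "exp_prod L e \<beta> js = foldr (\<lambda>j. exp_op \<beta> (crossing_op L e j)) js"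

definition next_arc :: "link \<Rightarrow> nat set \<Rightarrow> (real^3) set \<Rightarrow> (real^3) set" where
  "next_arc L S a =
     (if \<exists>i\<in>{1..ncross L}. \<exists>b. a = in_arc L i b
      then (THE c. \<exists>i\<in>{1..ncross L}. \<exists>b. a = in_arc L i b \<and>
                    c = out_arc L i (if i \<in> S then \<not> b else b))
      else a)"

definition cycle_from :: "link \<Rightarrow> nat set \<Rightarrow> (real^3) set \<Rightarrow> (real^3) set list" where
  "cycle_from L S a = map (\<lambda>n. (next_arc L S ^^ n) a) [0..<card (orbit (next_arc L S) a)]"

definition matrix_prod_list :: "(complex^'n^'n) list \<Rightarrow> complex^('n::finite)^'n" where
  "matrix_prod_list Ms = foldr (**) Ms (mat 1)"

text \<open>The trace does not depend on the arc at which a cyclic sequence is entered.\<close>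

definition wilson_function :: "link \<Rightarrow> nat set \<Rightarrow> ('n::finite) arc_function" where
  "wilson_function L S =
     (\<lambda>h. \<Prod>c \<in> orbit (next_arc L S) ` arcs L.
        trace (matrix_prod_list (map h (cycle_from L S (SOME a. a \<in> c)))))"

definition link_expectation ::
    "link \<Rightarrow> ('b::finite \<Rightarrow> complex^'n^'n) \<Rightarrow> complex \<Rightarrow> ('n::finite) arc_function" where
  "link_expectation L e lam =
     exp_prod L e (1 / (2 * lam)) [1..<Suc (ncross L)] (wilson_function L {})"

definition su :: "(complex^'n^'n) set" where
  "su = {X. (\<chi> r s. cnj (X $ s $ r)) = - X \<and> trace X = 0}"

definition background_connection ::
    "(complex^'n^'n) set \<Rightarrow> (real^3 \<Rightarrow> real^3 \<Rightarrow> complex^('n::finite)^'n) \<Rightarrow> bool" where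
  "background_connection g A \<longleftrightarrow>
     (\<forall>x. linear (A x)) \<and> (\<forall>v. continuous_on UNIV (\<lambda>x. A x v)) \<and>
     (\<forall>x v. A x v \<in> g) \<and> (\<forall>x. A x (axis 3 1) = 0)"

text \<open>With \<open>U' = U A(\<gamma>')\<close>, holonomies multiply left to right in order of traversal, and a
  variation of \<open>A\<close> at a point inserts \<open>e\<^sub>\<alpha>\<close> there with a positive sign.\<close>

definition path_holonomy ::
    "(real^3 \<Rightarrow> real^3 \<Rightarrow> complex^'n^'n) \<Rightarrow> (real \<Rightarrow> real^3) \<Rightarrow> real \<Rightarrow> real \<Rightarrow>
       complex^('n::finite)^'n" where
  "path_holonomy A \<gamma> s t = (THE u. \<exists>U. U s = mat 1 \<and> U t = u \<and>
     (\<forall>r\<in>{s..t}. (U has_vector_derivative (U r ** A (\<gamma> r) (vector_derivative \<gamma> (at r))))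
                   (at r within {s..t})))"

text \<open>An arc of a component with removed points is the image of an open parameter interval
  between two consecutive ones; a component without removed points is one closed arc, based at
  parameter 0.\<close>

definition arc_parameters :: "link \<Rightarrow> (real^3) set \<Rightarrow> nat \<Rightarrow> real \<Rightarrow> real \<Rightarrow> bool" where
  "arc_parameters L a j s t \<longleftrightarrow>
     (j, s) \<in> params L \<and> s < t \<and>
     (if range (curve L j) \<inter> removed_points L = {}
      then s = 0 \<and> t = 1 \<and> a = range (curve L j)
      else a \<in> arcs L \<and> a = curve L j ` {s<..<t} \<and>
           curve L j s \<in> removed_points L \<and> curve L j t \<in> removed_points L)"

definition arc_holonomy ::
    "link \<Rightarrow> (real^3 \<Rightarrow> real^3 \<Rightarrow> complex^'n^'n) \<Rightarrow> ('n::finite) assignment" where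
  "arc_holonomy L A a =
     (THE u. \<exists>j s t. arc_parameters L a j s t \<and> u = path_holonomy A (curve L j) s t)"

end

theory Submission
  imports Defs
begin

text \<open>Expanding all traces, \<open>W\<^sub>S\<close> is a sum over index assignments \<open>f\<close> to the arcs of
  \<open>\<Prod>a. h a $ f a $ f (\<sigma> a)\<close>, where \<open>\<sigma>\<close> is the successor permutation of the arcs. Smoothing
  a crossing composes \<open>\<sigma>\<close> with the transposition of the two incoming arcs, and this is exactly what
  the completeness relation
  \<open>\<Sum>\<alpha> \<beta>. (g\<^sup>-\<^sup>1)\<^sub>\<alpha>\<^sub>\<beta> e\<^sub>\<alpha> \<otimes> e\<^sub>\<beta> = P - 1/2\<close> of \<open>su(2)\<close> produces. Hence \<open>D\<^sub>i\<close> maps \<open>W\<^sub>S\<close> to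
  \<open>\<epsilon>\<^sub>i (2 W\<^sub>S\<^sub>\<union>\<^sub>i - W\<^sub>S)\<close> and \<open>W\<^sub>S\<^sub>\<union>\<^sub>i\<close> to \<open>\<epsilon>\<^sub>i (W\<^sub>S + W\<^sub>S\<^sub>\<union>\<^sub>i)\<close> for \<open>i \<notin> S\<close>. On the span of the
  \<open>W\<^sub>S\<close> the \<open>D\<^sub>i\<close> therefore commute and satisfy \<open>D\<^sub>i\<^sup>2 = 3\<close>, so that
  \<open>exp (\<beta> D\<^sub>i) = cosh (\<surd>3 \<beta>) + sinh (\<surd>3 \<beta>) / \<surd>3 \<cdot> D\<^sub>i\<close>.\<close>

subsection \<open>Index contractions along a permutation\<close>

text \<open>The two rows for \<open>D\<^sub>i\<close> differ because of where the half-insertions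
  land. If i is not in S, right multiplication of in(p) and left multiplication of out(p) act at the
  same junction; the halves add up to one insertion at each of the two junctions, and the
  completeness relation is used once. If i is in S, each derivative spreads its halves over both
  junctions. Of the four terms, each with weight 1/4, two have the generators at different junctions
  and again give P - 1/2, while the two with both generators at one junction give the Casimir value
  2 - 1/2 = 3/2. On the pair of W's the operator is thus a sign times a matrix of trace 0 and
  determinant -3, which is where 3 comes from. Two features of the setting shape the proof. An arc
  can be its own successor, and a smoothing may merge or split loops; summing over all index
  assignments makes these cases uniform. The derivatives are specified only on polynomial functions,
  so linearity and commutation are claimed only there and on the span of the W's.\<close>

definition contraction ::
    "'a set \<Rightarrow> ('a \<Rightarrow> 'a) \<Rightarrow> ('a \<Rightarrow> complex^'n^'n) \<Rightarrow> complex" where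
  "contraction X \<sigma> h =
     (\<Sum>f\<in>X \<rightarrow>\<^sub>E (UNIV :: 'n::finite set). \<Prod>a\<in>X. h a $ f a $ f (\<sigma> a))"

lemma contraction_cong:
  assumes "\<And>a. a \<in> X \<Longrightarrow> h a = k a" "\<And>a. a \<in> X \<Longrightarrow> \<sigma> a = \<tau> a"
  shows "contraction X \<sigma> h = contraction X \<tau> k"
  unfolding contraction_def using assms by (intro sum.cong prod.cong) auto

lemma sum_PiE_reindex:
  assumes "bij_betw \<sigma> Y X"
  shows "(\<Sum>f\<in>X \<rightarrow>\<^sub>E (UNIV :: 'n set). F f) =
         (\<Sum>f\<in>Y \<rightarrow>\<^sub>E (UNIV :: 'n set). F (\<lambda>x\<in>X. f (the_inv_into Y \<sigma> x)))"
proof (rule sum.reindex_bij_witness[of _ "\<lambda>f. \<lambda>x\<in>X. f (the_inv_into Y \<sigma> x)"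
      "\<lambda>f. \<lambda>y\<in>Y. f (\<sigma> y)"])
  fix f assume f: "f \<in> X \<rightarrow>\<^sub>E (UNIV :: 'n set)"
  have "(\<lambda>y\<in>Y. f (\<sigma> y)) (the_inv_into Y \<sigma> x) = f x" if "x \<in> X" for x
    using that assms
    by (metis (no_types, lifting) bij_betw_def f_the_inv_into_f_bij_betw restrict_apply'
        the_inv_into_into order_refl)
  then show eq: "(\<lambda>x\<in>X. (\<lambda>y\<in>Y. f (\<sigma> y)) (the_inv_into Y \<sigma> x)) = f"
    using f by (auto simp: fun_eq_iff PiE_def extensional_def)
  then show "F (\<lambda>x\<in>X. (\<lambda>y\<in>Y. f (\<sigma> y)) (the_inv_into Y \<sigma> x)) = F f" by simp
next
  fix f assume f: "f \<in> Y \<rightarrow>\<^sub>E (UNIV :: 'n set)"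
  have "(\<lambda>x\<in>X. f (the_inv_into Y \<sigma> x)) (\<sigma> y) = f y" if "y \<in> Y" for y
    using that assms by (auto simp: bij_betw_def the_inv_into_f_f)
  then show "(\<lambda>y\<in>Y. (\<lambda>x\<in>X. f (the_inv_into Y \<sigma> x)) (\<sigma> y)) = f"
    using f by (auto simp: fun_eq_iff PiE_def extensional_def)
qed auto

lemma sum_rotate:
  "(\<Sum>a\<in>A. \<Sum>b\<in>B. \<Sum>c\<in>C. f a b c) = (\<Sum>c\<in>C. \<Sum>a\<in>A. \<Sum>b\<in>B. f a b c)"
proof -
  have "(\<Sum>a\<in>A. \<Sum>b\<in>B. \<Sum>c\<in>C. f a b c) = (\<Sum>a\<in>A. \<Sum>c\<in>C. \<Sum>b\<in>B. f a b c)"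
    by (intro sum.cong refl sum.swap)
  then show ?thesis by (simp add: sum.swap[of _ C A])
qed

text \<open>Every matrix product needs an intermediate index. Distributing the product over
  \<open>X\<close> of the inner sums collects these indices into a second assignment
  \<open>g\<close>.\<close>

lemma contraction_mult_eq:
  fixes A B :: "'a \<Rightarrow> complex^'n^('n::finite)"
  assumes "finite X"
  shows "contraction X \<sigma> (\<lambda>a. A a ** B a) =
    (\<Sum>f\<in>X \<rightarrow>\<^sub>E UNIV. \<Sum>g\<in>X \<rightarrow>\<^sub>E UNIV.
       (\<Prod>a\<in>X. A a $ f a $ g a) * (\<Prod>a\<in>X. B a $ g a $ f (\<sigma> a)))"
proof -
  have "(\<Prod>a\<in>X. (A a ** B a) $ f a $ f (\<sigma> a)) =
      (\<Sum>g\<in>X \<rightarrow>\<^sub>E UNIV. (\<Prod>a\<in>X. A a $ f a $ g a) * (\<Prod>a\<in>X. B a $ g a $ f (\<sigma> a)))" for f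
    unfolding matrix_matrix_mult_def prod.distrib[symmetric]
    using assms by (simp add: prod_sum_PiE)
  then show ?thesis unfolding contraction_def by simp
qed

text \<open>Cyclicity of the trace for all cycles of \<open>\<sigma>\<close> at once; going through two index
  assignments makes fixed points of \<open>\<sigma>\<close> unexceptional.\<close>

lemma contraction_cyclic:
  fixes A B :: "'a \<Rightarrow> complex^'n^('n::finite)"
  assumes fin: "finite X" and bij: "bij_betw \<sigma> X X"
  shows "contraction X \<sigma> (\<lambda>a. A a ** B (\<sigma> a)) = contraction X \<sigma> (\<lambda>a. B a ** A a)"
proof -
  have mem: "\<And>a. a \<in> X \<Longrightarrow> \<sigma> a \<in> X" using bij by (auto simp: bij_betw_def)
  have inv: "\<And>a. a \<in> X \<Longrightarrow> the_inv_into X \<sigma> (\<sigma> a) = a"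
    using bij by (auto simp: bij_betw_def the_inv_into_f_f)
  have "contraction X \<sigma> (\<lambda>a. A a ** B (\<sigma> a)) =
     (\<Sum>f\<in>X \<rightarrow>\<^sub>E UNIV. \<Sum>g\<in>X \<rightarrow>\<^sub>E UNIV.
       (\<Prod>a\<in>X. A a $ f a $ g a) * (\<Prod>a\<in>X. B (\<sigma> a) $ g a $ f (\<sigma> a)))"
    by (rule contraction_mult_eq[OF fin])
  also have "\<dots> = (\<Sum>g\<in>X \<rightarrow>\<^sub>E UNIV. \<Sum>f\<in>X \<rightarrow>\<^sub>E UNIV.
       (\<Prod>a\<in>X. A a $ f a $ g a) * (\<Prod>a\<in>X. B (\<sigma> a) $ g a $ f (\<sigma> a)))"
    by (rule sum.swap)
  \<comment> \<open>\<open>g\<close> is re-based at the successor arc: \<open>g a\<close> is the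
    value at \<open>\<sigma> a\<close> of \<open>g\<close> composed with the inverse of
    \<open>\<sigma>\<close>. The two assignments thereby exchange roles.\<close>
  also have "\<dots> = (\<Sum>g\<in>X \<rightarrow>\<^sub>E UNIV. \<Sum>f\<in>X \<rightarrow>\<^sub>E UNIV.
       (\<Prod>a\<in>X. B a $ (\<lambda>x\<in>X. g (the_inv_into X \<sigma> x)) a $ f a) *
       (\<Prod>a\<in>X. A a $ f a $ (\<lambda>x\<in>X. g (the_inv_into X \<sigma> x)) (\<sigma> a)))"
  proof (intro sum.cong refl)
    fix g f :: "'a \<Rightarrow> 'n"
    let ?f = "\<lambda>x\<in>X. g (the_inv_into X \<sigma> x)"
    have "(\<Prod>a\<in>X. A a $ f a $ g a) = (\<Prod>a\<in>X. A a $ f a $ ?f (\<sigma> a))"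
      by (intro prod.cong) (auto simp: mem inv)
    moreover have "(\<Prod>a\<in>X. B (\<sigma> a) $ g a $ f (\<sigma> a)) = (\<Prod>a\<in>X. B a $ ?f a $ f a)"
    proof -
      have "(\<Prod>a\<in>X. B a $ ?f a $ f a) = (\<Prod>a\<in>X. B (\<sigma> a) $ ?f (\<sigma> a) $ f (\<sigma> a))"
        by (rule prod.reindex_bij_betw[OF bij, symmetric])
      also have "\<dots> = (\<Prod>a\<in>X. B (\<sigma> a) $ g a $ f (\<sigma> a))"
        by (intro prod.cong) (auto simp: mem inv)
      finally show ?thesis by simp
    qed
    ultimately show "(\<Prod>a\<in>X. A a $ f a $ g a) * (\<Prod>a\<in>X. B (\<sigma> a) $ g a $ f (\<sigma> a)) =
      (\<Prod>a\<in>X. B a $ ?f a $ f a) * (\<Prod>a\<in>X. A a $ f a $ ?f (\<sigma> a))"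
      by (simp add: mult.commute)
  qed
  also have "\<dots> = (\<Sum>f\<in>X \<rightarrow>\<^sub>E UNIV. \<Sum>g\<in>X \<rightarrow>\<^sub>E UNIV.
       (\<Prod>a\<in>X. B a $ f a $ g a) * (\<Prod>a\<in>X. A a $ g a $ f (\<sigma> a)))"
    by (rule sum_PiE_reindex[OF bij, symmetric])
  also have "\<dots> = contraction X \<sigma> (\<lambda>a. B a ** A a)"
    by (rule contraction_mult_eq[OF fin, symmetric])
  finally show ?thesis .
qed

text \<open>This is the cyclic identity for a \<open>B\<close> that is \<open>Y\<close> at
  \<open>\<sigma> q\<close> and the identity matrix elsewhere. Injectivity of
  \<open>\<sigma>\<close> makes \<open>q\<close> the only arc whose successor carries
  \<open>Y\<close>.\<close>

lemma contraction_slide: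
  fixes k :: "'a \<Rightarrow> complex^'n^('n::finite)"
  assumes "finite X" "bij_betw \<sigma> X X" "q \<in> X"
  shows "contraction X \<sigma> (k(\<sigma> q := Y ** k (\<sigma> q))) = contraction X \<sigma> (k(q := k q ** Y))"
proof -
  let ?B = "\<lambda>a. if a = \<sigma> q then Y else mat 1"
  have "contraction X \<sigma> (k(\<sigma> q := Y ** k (\<sigma> q))) = contraction X \<sigma> (\<lambda>a. ?B a ** k a)"
    by (intro contraction_cong) auto
  also have "\<dots> = contraction X \<sigma> (\<lambda>a. k a ** ?B (\<sigma> a))"
    by (rule contraction_cyclic[OF assms(1,2), symmetric])
  also have "\<dots> = contraction X \<sigma> (k(q := k q ** Y))"
    using assms(2,3) by (intro contraction_cong) (auto simp: bij_betw_def inj_on_def)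
  finally show ?thesis .
qed

section \<open>Linearity in a single arc and the completeness relation\<close>

lemma contraction_remove:
  assumes "finite X" "a \<in> X"
  shows "contraction X \<sigma> h =
    (\<Sum>f\<in>X \<rightarrow>\<^sub>E UNIV. h a $ f a $ f (\<sigma> a) * (\<Prod>c\<in>X - {a}. h c $ f c $ f (\<sigma> c)))"
  unfolding contraction_def using assms by (simp add: prod.remove)

lemma contraction_upd:
  assumes "finite X" "a \<in> X"
  shows "contraction X \<sigma> (h(a := M)) =
    (\<Sum>f\<in>X \<rightarrow>\<^sub>E UNIV. M $ f a $ f (\<sigma> a) * (\<Prod>c\<in>X - {a}. h c $ f c $ f (\<sigma> c)))"
  by (subst contraction_remove[OF assms]) (auto intro!: sum.cong)

lemma contraction_upd_sum:
  assumes "finite X" "a \<in> X" "finite I"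
    and "\<And>p q. M $ p $ q = (\<Sum>j\<in>I. c j * N j $ p $ q)"
  shows "contraction X \<sigma> (h(a := M)) = (\<Sum>j\<in>I. c j * contraction X \<sigma> (h(a := N j)))"
proof -
  let ?R = "\<lambda>f. \<Prod>c\<in>X - {a}. h c $ f c $ f (\<sigma> c)"
  have "(\<Sum>j\<in>I. c j * contraction X \<sigma> (h(a := N j))) =
    (\<Sum>j\<in>I. \<Sum>f\<in>X \<rightarrow>\<^sub>E UNIV. c j * N j $ f a $ f (\<sigma> a) * ?R f)"
    by (simp add: contraction_upd[OF assms(1,2)] sum_distrib_left mult.assoc)
  also have "\<dots> = (\<Sum>f\<in>X \<rightarrow>\<^sub>E UNIV. (\<Sum>j\<in>I. c j * N j $ f a $ f (\<sigma> a)) * ?R f)"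
    by (subst sum.swap) (simp add: sum_distrib_right)
  finally show ?thesis by (simp add: contraction_upd[OF assms(1,2)] assms(4))
qed

lemma contraction_upd_add:
  assumes "finite X" "a \<in> X"
  shows "contraction X \<sigma> (h(a := M + N)) =
    contraction X \<sigma> (h(a := M)) + contraction X \<sigma> (h(a := N))"
  by (simp add: contraction_upd[OF assms] distrib_right sum.distrib)

lemma contraction_upd_scale:
  assumes "finite X" "a \<in> X" "\<And>p q. N $ p $ q = c * M $ p $ q"
  shows "contraction X \<sigma> (h(a := N)) = c * contraction X \<sigma> (h(a := M))"
  by (simp add: contraction_upd[OF assms(1,2)] assms(3) sum_distrib_left mult.assoc)

text \<open>As an operator on a tensor square, the left-hand side is the flip of the two factors
  minus \<kappa> times the identity. The value \<kappa> = 1/n belongs to su(n), where the trace part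
  is removed.\<close>

definition fierz ::
    "complex \<Rightarrow> ('b \<Rightarrow> 'b \<Rightarrow> complex) \<Rightarrow> ('b::finite \<Rightarrow> complex^'n^('n::finite)) \<Rightarrow> bool" where
  "fierz \<kappa> C e \<longleftrightarrow> (\<forall>p q r s.
     (\<Sum>\<alpha>\<in>UNIV. \<Sum>\<beta>\<in>UNIV. C \<alpha> \<beta> * (e \<alpha> $ p $ q * e \<beta> $ r $ s)) =
       (if p = s \<and> q = r then 1 else 0) - \<kappa> * (if p = q \<and> r = s then 1 else 0))"

text \<open>Identifying and summing the inner indices, the flip leaves a free index running through
  \<open>CARD('n)\<close> values and the identity term leaves \<kappa>. The result is the quadratic
  Casimir scalar, 3/2 for su(2).\<close>

lemma fierz_product:
  fixes e :: "'b::finite \<Rightarrow> complex^'n^('n::finite)"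
  assumes "fierz \<kappa> C e"
  shows "(\<Sum>\<alpha>\<in>UNIV. \<Sum>\<beta>\<in>UNIV. C \<alpha> \<beta> * (e \<alpha> ** e \<beta>) $ p $ s) =
           (if p = s then of_nat CARD('n) - \<kappa> else 0)"
    and "(\<Sum>\<alpha>\<in>UNIV. \<Sum>\<beta>\<in>UNIV. C \<alpha> \<beta> * (e \<beta> ** e \<alpha>) $ p $ s) =
           (if p = s then of_nat CARD('n) - \<kappa> else 0)"
proof -
  have *: "(\<Sum>q\<in>UNIV. (if p = s \<and> q = q then 1 else 0) - \<kappa> * (if p = q \<and> q = s then 1 else 0)) =
     (if p = s then of_nat CARD('n) - \<kappa> else 0)" for p s :: 'n
    by (cases "p = s")
      (auto simp: sum_subtractf sum_distrib_left[symmetric] eq_commute[of s] intro!: sum.neutral)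
  have **: "(\<Sum>q\<in>UNIV. (if q = q \<and> s = p then 1 else 0) - \<kappa> * (if q = s \<and> p = q then 1 else 0)) =
     (if p = s then of_nat CARD('n) - \<kappa> else 0)" for p s :: 'n
    by (cases "p = s")
      (auto simp: sum_subtractf sum_distrib_left[symmetric] eq_commute[of s] intro!: sum.neutral)
  have "(\<Sum>\<alpha>\<in>UNIV. \<Sum>\<beta>\<in>UNIV. C \<alpha> \<beta> * (e \<alpha> ** e \<beta>) $ p $ s) =
    (\<Sum>q\<in>UNIV. \<Sum>\<alpha>\<in>UNIV. \<Sum>\<beta>\<in>UNIV. C \<alpha> \<beta> * (e \<alpha> $ p $ q * e \<beta> $ q $ s))"
    unfolding matrix_matrix_mult_def vec_lambda_beta sum_distrib_left
    by (rule sum_rotate)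
  then show "(\<Sum>\<alpha>\<in>UNIV. \<Sum>\<beta>\<in>UNIV. C \<alpha> \<beta> * (e \<alpha> ** e \<beta>) $ p $ s) =
           (if p = s then of_nat CARD('n) - \<kappa> else 0)"
    using assms * unfolding fierz_def by simp
  have "(\<Sum>\<alpha>\<in>UNIV. \<Sum>\<beta>\<in>UNIV. C \<alpha> \<beta> * (e \<beta> ** e \<alpha>) $ p $ s) =
    (\<Sum>q\<in>UNIV. \<Sum>\<alpha>\<in>UNIV. \<Sum>\<beta>\<in>UNIV. C \<alpha> \<beta> * (e \<alpha> $ q $ s * e \<beta> $ p $ q))"
    unfolding matrix_matrix_mult_def vec_lambda_beta sum_distrib_left
    by (subst sum_rotate) (simp add: mult_ac)
  then show "(\<Sum>\<alpha>\<in>UNIV. \<Sum>\<beta>\<in>UNIV. C \<alpha> \<beta> * (e \<beta> ** e \<alpha>) $ p $ s) =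
           (if p = s then of_nat CARD('n) - \<kappa> else 0)"
    using assms ** unfolding fierz_def by simp
qed

text \<open>With both generators at one junction their weighted sum is a scalar matrix, which comes
  out by linearity in the arc \<open>a\<close>. The pair of generator labels serves as a single
  summation index.\<close>

lemma contraction_fierz_same:
  fixes E :: "'b::finite \<Rightarrow> 'b \<Rightarrow> complex^'n^('n::finite)"
  assumes "finite X" "a \<in> X"
    and "\<And>p s. (\<Sum>\<alpha>\<in>UNIV. \<Sum>\<beta>\<in>UNIV. C \<alpha> \<beta> * E \<alpha> \<beta> $ p $ s) = (if p = s then c else 0)"
  shows "(\<Sum>\<alpha>\<in>UNIV. \<Sum>\<beta>\<in>UNIV. C \<alpha> \<beta> * contraction X \<sigma> (h(a := h a ** E \<alpha> \<beta>))) =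
    c * contraction X \<sigma> (h :: 'a \<Rightarrow> complex^'n^'n)"
proof -
  have entry: "(\<Sum>j\<in>UNIV. (case j of (\<alpha>, \<beta>) \<Rightarrow> C \<alpha> \<beta>) * (h a ** (case j of (\<alpha>, \<beta>) \<Rightarrow> E \<alpha> \<beta>)) $ p $ q)
      = c * h a $ p $ q" for p q
  proof -
    have "(\<Sum>j\<in>UNIV. (case j of (\<alpha>, \<beta>) \<Rightarrow> C \<alpha> \<beta>) * (h a ** (case j of (\<alpha>, \<beta>) \<Rightarrow> E \<alpha> \<beta>)) $ p $ q) =
      (\<Sum>\<alpha>\<in>UNIV. \<Sum>\<beta>\<in>UNIV. \<Sum>r\<in>UNIV. C \<alpha> \<beta> * (h a $ p $ r * E \<alpha> \<beta> $ r $ q))"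
      unfolding UNIV_Times_UNIV[symmetric] sum.cartesian_product'
      by (simp add: sum.cartesian_product matrix_matrix_mult_def sum_distrib_left case_prod_beta)
    also have "\<dots> = (\<Sum>r\<in>UNIV. \<Sum>\<alpha>\<in>UNIV. \<Sum>\<beta>\<in>UNIV. C \<alpha> \<beta> * (h a $ p $ r * E \<alpha> \<beta> $ r $ q))"
      by (rule sum_rotate)
    also have "\<dots> = (\<Sum>r\<in>UNIV. h a $ p $ r * (\<Sum>\<alpha>\<in>UNIV. \<Sum>\<beta>\<in>UNIV. C \<alpha> \<beta> * E \<alpha> \<beta> $ r $ q))"
      by (simp add: sum_distrib_left mult_ac)
    also have "\<dots> = c * h a $ p $ q"
      by (simp add: assms(3) if_distrib[of "(*) _"] mult.commute cong: if_cong)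
    finally show ?thesis .
  qed
  have "c * contraction X \<sigma> h = contraction X \<sigma> (h(a := (\<chi> p q. c * h a $ p $ q)))"
    by (subst contraction_upd_scale[OF assms(1,2), where M="h a" and c=c]) auto
  also have "\<dots> = (\<Sum>j\<in>UNIV. (case j of (\<alpha>, \<beta>) \<Rightarrow> C \<alpha> \<beta>) *
      contraction X \<sigma> (h(a := h a ** (case j of (\<alpha>, \<beta>) \<Rightarrow> E \<alpha> \<beta>))))"
    by (rule contraction_upd_sum[OF assms(1,2)]) (simp_all add: entry)
  also have "\<dots> = (\<Sum>\<alpha>\<in>UNIV. \<Sum>\<beta>\<in>UNIV. C \<alpha> \<beta> * contraction X \<sigma> (h(a := h a ** E \<alpha> \<beta>)))"
    unfolding UNIV_Times_UNIV[symmetric] sum.cartesian_product by (simp add: case_prod_beta)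
  finally show ?thesis by simp
qed

text \<open>The flip exchanges the column indices \<open>f (\<sigma> a)\<close> and
  \<open>f (\<sigma> b)\<close>, which amounts to exchanging the successors of \<open>a\<close> and
  \<open>b\<close>. The term with \<kappa> keeps the old successors.\<close>

lemma contraction_fierz_swap:
  fixes e :: "'b::finite \<Rightarrow> complex^'n^('n::finite)" and h :: "'a \<Rightarrow> complex^'n^'n"
  assumes fin: "finite X" and ab: "a \<in> X" "b \<in> X" "a \<noteq> b" and fz: "fierz \<kappa> C e"
    and \<tau>: "\<tau> a = \<sigma> b" "\<tau> b = \<sigma> a" "\<And>c. c \<in> X \<Longrightarrow> c \<noteq> a \<Longrightarrow> c \<noteq> b \<Longrightarrow> \<tau> c = \<sigma> c"
  shows "(\<Sum>\<alpha>\<in>UNIV. \<Sum>\<beta>\<in>UNIV. C \<alpha> \<beta> *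
            contraction X \<sigma> (h(a := h a ** e \<alpha>, b := h b ** e \<beta>))) =
    contraction X \<tau> h - \<kappa> * contraction X \<sigma> h"
proof -
  let ?R = "\<lambda>f. \<Prod>c\<in>X - {a} - {b}. h c $ f c $ f (\<sigma> c)"
  \<comment> \<open>The factors of \<open>a\<close> and \<open>b\<close> are split off; the rest
    \<open>?R\<close> is common to all contractions that are compared.\<close>
  have exp: "contraction X \<rho> k = (\<Sum>f\<in>X \<rightarrow>\<^sub>E UNIV. k a $ f a $ f (\<rho> a) * k b $ f b $ f (\<rho> b) * ?R f)"
    if "\<And>c. c \<in> X \<Longrightarrow> c \<noteq> a \<Longrightarrow> c \<noteq> b \<Longrightarrow> k c = h c \<and> \<rho> c = \<sigma> c" for \<rho> k
    unfolding contraction_def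
  proof (rule sum.cong[OF refl])
    fix f
    have "(\<Prod>c\<in>X - {a} - {b}. k c $ f c $ f (\<rho> c)) = ?R f"
      using that by (intro prod.cong) auto
    then show "(\<Prod>c\<in>X. k c $ f c $ f (\<rho> c)) =
        k a $ f a $ f (\<rho> a) * k b $ f b $ f (\<rho> b) * ?R f"
      using fin ab by (simp add: prod.remove[of X a] prod.remove[of "X - {a}" b] mult.assoc)
  qed
  have entry: "(\<Sum>\<alpha>\<in>UNIV. \<Sum>\<beta>\<in>UNIV. C \<alpha> \<beta> * ((h a ** e \<alpha>) $ p $ q * (h b ** e \<beta>) $ r $ s)) =
     h a $ p $ s * h b $ r $ q - \<kappa> * (h a $ p $ q * h b $ r $ s)" for p q r s
  proof -
    have "(\<Sum>\<alpha>\<in>UNIV. \<Sum>\<beta>\<in>UNIV. C \<alpha> \<beta> * ((h a ** e \<alpha>) $ p $ q * (h b ** e \<beta>) $ r $ s)) =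
      (\<Sum>\<alpha>\<in>UNIV. \<Sum>\<beta>\<in>UNIV. \<Sum>x\<in>UNIV. \<Sum>y\<in>UNIV.
         h a $ p $ x * h b $ r $ y * (C \<alpha> \<beta> * (e \<alpha> $ x $ q * e \<beta> $ y $ s)))"
      unfolding matrix_matrix_mult_def vec_lambda_beta sum_product
      by (simp add: sum_distrib_left mult_ac)
    also have "\<dots> = (\<Sum>x\<in>UNIV. \<Sum>\<alpha>\<in>UNIV. \<Sum>\<beta>\<in>UNIV. \<Sum>y\<in>UNIV.
         h a $ p $ x * h b $ r $ y * (C \<alpha> \<beta> * (e \<alpha> $ x $ q * e \<beta> $ y $ s)))"
      by (rule sum_rotate)
    also have "\<dots> = (\<Sum>x\<in>UNIV. \<Sum>y\<in>UNIV. \<Sum>\<alpha>\<in>UNIV. \<Sum>\<beta>\<in>UNIV.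
         h a $ p $ x * h b $ r $ y * (C \<alpha> \<beta> * (e \<alpha> $ x $ q * e \<beta> $ y $ s)))"
      by (rule sum.cong[OF refl]) (rule sum_rotate)
    also have "\<dots> = (\<Sum>x\<in>UNIV. \<Sum>y\<in>UNIV. h a $ p $ x * h b $ r $ y *
         ((if x = s \<and> q = y then 1 else 0) - \<kappa> * (if x = q \<and> y = s then 1 else 0)))"
      using fz unfolding fierz_def by (simp add: sum_distrib_left[symmetric])
    also have "\<dots> = (\<Sum>x\<in>UNIV. \<Sum>y\<in>UNIV.
        (if x = s then if y = q then h a $ p $ x * h b $ r $ y else 0 else 0) -
        \<kappa> * (if x = q then if y = s then h a $ p $ x * h b $ r $ y else 0 else 0))"
      by (intro sum.cong refl) (auto simp: algebra_simps)
    also have "\<dots> = (\<Sum>x\<in>UNIV.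
        (if x = s then h a $ p $ x * h b $ r $ q else 0) -
        \<kappa> * (if x = q then h a $ p $ x * h b $ r $ s else 0))"
      unfolding sum_subtractf sum_distrib_left[symmetric]
      by (intro arg_cong2[where f="(-)"] arg_cong2[where f="(*)"] sum.cong refl) auto
    also have "\<dots> = h a $ p $ s * h b $ r $ q - \<kappa> * (h a $ p $ q * h b $ r $ s)"
      unfolding sum_subtractf sum_distrib_left[symmetric] by simp
    finally show ?thesis .
  qed
  have "(\<Sum>\<alpha>\<in>UNIV. \<Sum>\<beta>\<in>UNIV. C \<alpha> \<beta> *
            contraction X \<sigma> (h(a := h a ** e \<alpha>, b := h b ** e \<beta>))) =
    (\<Sum>\<alpha>\<in>UNIV. \<Sum>\<beta>\<in>UNIV. \<Sum>f\<in>X \<rightarrow>\<^sub>E UNIV.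
        C \<alpha> \<beta> * ((h a ** e \<alpha>) $ f a $ f (\<sigma> a) * (h b ** e \<beta>) $ f b $ f (\<sigma> b)) * ?R f)"
    using ab(3) by (subst exp) (auto simp: sum_distrib_left mult.assoc)
  also have "\<dots> = (\<Sum>f\<in>X \<rightarrow>\<^sub>E UNIV. \<Sum>\<alpha>\<in>UNIV. \<Sum>\<beta>\<in>UNIV.
        C \<alpha> \<beta> * ((h a ** e \<alpha>) $ f a $ f (\<sigma> a) * (h b ** e \<beta>) $ f b $ f (\<sigma> b)) * ?R f)"
    by (rule sum_rotate)
  also have "\<dots> = (\<Sum>f\<in>X \<rightarrow>\<^sub>E UNIV.
      (h a $ f a $ f (\<sigma> b) * h b $ f b $ f (\<sigma> a) -
       \<kappa> * (h a $ f a $ f (\<sigma> a) * h b $ f b $ f (\<sigma> b))) * ?R f)"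
    by (simp add: sum_distrib_right[symmetric] entry)
  also have "\<dots> = contraction X \<tau> h - \<kappa> * contraction X \<sigma> h"
    using \<tau> by (simp add: exp[of h \<tau>] exp[of h \<sigma>] left_diff_distrib sum_subtractf
        sum_distrib_left mult.assoc)
  finally show ?thesis .
qed

section \<open>Contractions as products of traces over cycles\<close>

lemma contraction_reindex:
  assumes bij: "bij_betw \<phi> Y X" and mem: "\<And>y. y \<in> Y \<Longrightarrow> \<tau> y \<in> Y"
    and comm: "\<And>y. y \<in> Y \<Longrightarrow> \<sigma> (\<phi> y) = \<phi> (\<tau> y)"
  shows "contraction X \<sigma> h = contraction Y \<tau> (h \<circ> \<phi>)"
proof -
  have X: "\<And>y. y \<in> Y \<Longrightarrow> \<phi> y \<in> X" using bij by (auto simp: bij_betw_def)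
  have inv: "\<And>y. y \<in> Y \<Longrightarrow> the_inv_into Y \<phi> (\<phi> y) = y"
    using bij by (auto simp: bij_betw_def the_inv_into_f_f)
  show ?thesis
    unfolding contraction_def sum_PiE_reindex[OF bij] prod.reindex_bij_betw[OF bij, symmetric]
    by (intro sum.cong prod.cong refl) (auto simp: X inv comm mem)
qed

lemma contraction_Un:
  fixes h :: "'a \<Rightarrow> complex^'n^('n::finite)"
  assumes fin: "finite X" "finite Y" and disj: "X \<inter> Y = {}"
    and X: "\<And>x. x \<in> X \<Longrightarrow> \<sigma> x \<in> X" and Y: "\<And>y. y \<in> Y \<Longrightarrow> \<sigma> y \<in> Y"
  shows "contraction (X \<union> Y) \<sigma> h = contraction X \<sigma> h * contraction Y \<sigma> h"
proof -
  let ?F = "\<lambda>A f. \<Prod>a\<in>A. h a $ f a $ f (\<sigma> a)"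
  have "contraction (X \<union> Y) \<sigma> h =
    (\<Sum>p\<in>(X \<rightarrow>\<^sub>E UNIV) \<times> (Y \<rightarrow>\<^sub>E UNIV). ?F X (fst p) * ?F Y (snd p))"
    unfolding contraction_def
  \<comment> \<open>Outside \<open>X \<union> Y\<close> the glued function takes the value of
    \<open>snd p\<close>, which is \<open>undefined\<close> there, so it is again
    extensional.\<close>
  proof (rule sum.reindex_bij_witness[of _ "\<lambda>p x. if x \<in> X then fst p x else snd p x"
        "\<lambda>f. (restrict f X, restrict f Y)"])
    fix f :: "'a \<Rightarrow> 'n" assume "f \<in> X \<union> Y \<rightarrow>\<^sub>E UNIV"
    then show "(\<lambda>x. if x \<in> X then fst (restrict f X, restrict f Y) x
        else snd (restrict f X, restrict f Y) x) = f"
      by (auto simp: fun_eq_iff PiE_def extensional_def)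
    have "?F X f = ?F X (restrict f X)" "?F Y f = ?F Y (restrict f Y)"
      using X Y by (auto intro!: prod.cong)
    then show "?F X (fst (restrict f X, restrict f Y)) * ?F Y (snd (restrict f X, restrict f Y)) =
        ?F (X \<union> Y) f"
      using fin disj by (simp add: prod.union_disjoint)
  next
    fix p :: "('a \<Rightarrow> 'n) \<times> ('a \<Rightarrow> 'n)"
    assume p: "p \<in> (X \<rightarrow>\<^sub>E UNIV) \<times> (Y \<rightarrow>\<^sub>E UNIV)"
    then show "(\<lambda>x. if x \<in> X then fst p x else snd p x) \<in> X \<union> Y \<rightarrow>\<^sub>E UNIV"
      by (auto simp: PiE_def extensional_def)
    show "(restrict (\<lambda>x. if x \<in> X then fst p x else snd p x) X,
        restrict (\<lambda>x. if x \<in> X then fst p x else snd p x) Y) = p"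
      using p disj by (cases p) (auto simp: fun_eq_iff PiE_def extensional_def)
  qed auto
  also have "\<dots> = contraction X \<sigma> h * contraction Y \<sigma> h"
    unfolding contraction_def sum_product sum.cartesian_product by (simp add: case_prod_beta)
  finally show ?thesis .
qed

lemma contraction_Union:
  assumes "finite P" "\<And>c. c \<in> P \<Longrightarrow> finite c" "pairwise disjnt P"
    "\<And>c x. c \<in> P \<Longrightarrow> x \<in> c \<Longrightarrow> \<sigma> x \<in> c"
  shows "contraction (\<Union>P) \<sigma> h = (\<Prod>c\<in>P. contraction c \<sigma> h)"
  using assms
proof (induction P rule: finite_induct)
  case empty
  then show ?case by (simp add: contraction_def)
next
  case (insert c P)
  have "disjnt c d" if "d \<in> P" for d
    using pairwiseD[OF insert.prems(2), of c d] that insert.hyps(2) by auto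
  then have disj: "c \<inter> \<Union>P = {}" by (simp add: disjnt_def Int_Union)
  have c: "\<sigma> x \<in> c" if "x \<in> c" for x
    using insert.prems(3)[of c x] that by simp
  have closed: "\<sigma> x \<in> d" if "d \<in> P" "x \<in> d" for d x
    using insert.prems(3)[of d x] that by simp
  have fin: "finite c" "finite (\<Union>P)" using insert.prems(1) insert.hyps(1) by auto
  have "contraction (c \<union> \<Union>P) \<sigma> h = contraction c \<sigma> h * contraction (\<Union>P) \<sigma> h"
    by (rule contraction_Un[OF fin disj c]) (auto intro: closed)
  moreover have "contraction (\<Union>P) \<sigma> h = (\<Prod>c\<in>P. contraction c \<sigma> h)"
    using insert.prems(1,2) by (intro insert.IH closed) (auto simp: pairwise_insert)
  ultimately show ?case using insert.hyps by simp
qed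

lemma sum_PiE_insert:
  assumes "x \<notin> A"
  shows "(\<Sum>f\<in>insert x A \<rightarrow>\<^sub>E (UNIV :: 'n set). F f) =
    (\<Sum>g\<in>A \<rightarrow>\<^sub>E UNIV. \<Sum>y\<in>(UNIV :: 'n::finite set). F (g(x := y)))"
proof -
  have "(\<Sum>f\<in>insert x A \<rightarrow>\<^sub>E (UNIV :: 'n set). F f) =
      (\<Sum>(y, g)\<in>UNIV \<times> (A \<rightarrow>\<^sub>E UNIV). F (g(x := y)))"
    unfolding PiE_insert_eq using assms
    by (subst sum.reindex[OF inj_combinator]) (auto simp: case_prod_beta)
  also have "\<dots> = (\<Sum>y\<in>UNIV. \<Sum>g\<in>A \<rightarrow>\<^sub>E UNIV. F (g(x := y)))"
    by (rule sum.cartesian_product[symmetric])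
  also have "\<dots> = (\<Sum>g\<in>A \<rightarrow>\<^sub>E UNIV. \<Sum>y\<in>UNIV. F (g(x := y)))"
    by (rule sum.swap)
  finally show ?thesis .
qed

lemma matrix_prod_list_snoc:
  "matrix_prod_list (Ms @ [M]) = matrix_prod_list Ms ** M"
  by (induction Ms) (auto simp: matrix_prod_list_def matrix_mul_assoc)

text \<open>A product of \<open>n\<close> matrices is a sum over paths with \<open>n + 1\<close>
  indices, hence the domain \<open>{..n}\<close>; the two end indices are pinned to \<open>p\<close>
  and \<open>q\<close>.\<close>

lemma matrix_prod_list_entry:
  "matrix_prod_list (map M [0..<n]) $ p $ q =
    (\<Sum>f\<in>{..n} \<rightarrow>\<^sub>E (UNIV :: 'n::finite set).
      if f 0 = p \<and> f n = q then \<Prod>i<n. M i $ f i $ f (Suc i) else 0)"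
proof (induction n arbitrary: q)
  case 0
  have "(\<Sum>f\<in>insert 0 {} \<rightarrow>\<^sub>E (UNIV :: 'n set). if f (0::nat) = p \<and> f 0 = q then 1 else (0::complex)) =
    (\<Sum>y\<in>(UNIV :: 'n set). if y = p then if p = q then 1 else 0 else 0)"
    by (subst sum_PiE_insert) (auto intro!: sum.cong sum.neutral)
  moreover have "{..0::nat} = insert 0 {}" by auto
  moreover have "(if f 0 = p \<and> f 0 = q then \<Prod>i<0. M i $ f i $ f (Suc i) else 0) =
      (if f 0 = p \<and> f 0 = q then 1 else 0)" for f :: "nat \<Rightarrow> 'n"
    by auto
  ultimately show ?case by (simp only:) (simp add: matrix_prod_list_def mat_def)
next
  case (Suc n)
  have "{..Suc n} = insert (Suc n) {..n}" by auto
  then have "(\<Sum>f\<in>{..Suc n} \<rightarrow>\<^sub>E (UNIV :: 'n set).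
      if f 0 = p \<and> f (Suc n) = q then \<Prod>i<Suc n. M i $ f i $ f (Suc i) else 0) =
    (\<Sum>g\<in>{..n} \<rightarrow>\<^sub>E (UNIV :: 'n set). \<Sum>y\<in>UNIV.
      if (g(Suc n := y)) 0 = p \<and> (g(Suc n := y)) (Suc n) = q
      then \<Prod>i<Suc n. M i $ (g(Suc n := y)) i $ (g(Suc n := y)) (Suc i) else 0)"
    by (simp only:) (rule sum_PiE_insert, simp)
  also have "\<dots> = (\<Sum>g\<in>{..n} \<rightarrow>\<^sub>E (UNIV :: 'n set). \<Sum>y\<in>UNIV.
      if y = q then if g 0 = p then (\<Prod>i<n. M i $ g i $ g (Suc i)) * M n $ g n $ q else 0 else 0)"
  proof (intro sum.cong refl)
    fix g :: "nat \<Rightarrow> 'n" and y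
    have "(\<Prod>i<n. M i $ (g(Suc n := y)) i $ (g(Suc n := y)) (Suc i)) =
        (\<Prod>i<n. M i $ g i $ g (Suc i))"
      by (intro prod.cong) auto
    then have "(\<Prod>i<Suc n. M i $ (g(Suc n := y)) i $ (g(Suc n := y)) (Suc i)) =
        (\<Prod>i<n. M i $ g i $ g (Suc i)) * M n $ g n $ y"
      unfolding prod.lessThan_Suc by simp
    then show "(if (g(Suc n := y)) 0 = p \<and> (g(Suc n := y)) (Suc n) = q
        then \<Prod>i<Suc n. M i $ (g(Suc n := y)) i $ (g(Suc n := y)) (Suc i) else 0) =
      (if y = q then if g 0 = p then (\<Prod>i<n. M i $ g i $ g (Suc i)) * M n $ g n $ q else 0 else 0)"
      by (simp only:) simp
  qed
  also have "\<dots> = (\<Sum>g\<in>{..n} \<rightarrow>\<^sub>E (UNIV :: 'n set).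
      if g 0 = p then (\<Prod>i<n. M i $ g i $ g (Suc i)) * M n $ g n $ q else 0)"
    by simp
  also have "\<dots> = (\<Sum>g\<in>{..n} \<rightarrow>\<^sub>E (UNIV :: 'n set). \<Sum>r\<in>UNIV.
      (if g 0 = p \<and> g n = r then \<Prod>i<n. M i $ g i $ g (Suc i) else 0) * M n $ r $ q)"
  proof (intro sum.cong refl)
    fix g :: "nat \<Rightarrow> 'n"
    have "(\<Sum>r\<in>UNIV. (if g 0 = p \<and> g n = r then \<Prod>i<n. M i $ g i $ g (Suc i) else 0) * M n $ r $ q) =
      (\<Sum>r\<in>UNIV. if r = g n then (if g 0 = p then \<Prod>i<n. M i $ g i $ g (Suc i) else 0) * M n $ r $ q else 0)"
      by (intro sum.cong) auto
    then show "(if g 0 = p then (\<Prod>i<n. M i $ g i $ g (Suc i)) * M n $ g n $ q else 0) =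
      (\<Sum>r\<in>UNIV. (if g 0 = p \<and> g n = r then \<Prod>i<n. M i $ g i $ g (Suc i) else 0) * M n $ r $ q)"
      by simp
  qed
  also have "\<dots> = (\<Sum>r\<in>UNIV. matrix_prod_list (map M [0..<n]) $ p $ r * M n $ r $ q)"
    unfolding Suc.IH sum_distrib_right by (rule sum.swap)
  also have "\<dots> = matrix_prod_list (map M [0..<Suc n]) $ p $ q"
    by (simp add: matrix_prod_list_snoc matrix_matrix_mult_def)
  finally show ?case by (rule sym)
qed

text \<open>Taking the trace glues index \<open>n\<close> to index \<open>0\<close>, which turns the
  path into a cycle with successor \<open>Suc i mod n\<close>. For \<open>n = 1\<close> the only arc
  follows itself.\<close>

lemma trace_matrix_prod_list:
  fixes M :: "nat \<Rightarrow> complex^'n^('n::finite)"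
  assumes "n > 0"
  shows "trace (matrix_prod_list (map M [0..<n])) = contraction {..<n} (\<lambda>i. Suc i mod n) M"
proof -
  let ?F = "\<lambda>f. \<Prod>i<n. M i $ f i $ f (Suc i)"
  have "trace (matrix_prod_list (map M [0..<n])) =
    (\<Sum>f\<in>{..n} \<rightarrow>\<^sub>E UNIV. \<Sum>p\<in>UNIV. if f 0 = p \<and> f n = p then ?F f else 0)"
    unfolding trace_def matrix_prod_list_entry by (rule sum.swap)
  also have "\<dots> = (\<Sum>f\<in>{..n} \<rightarrow>\<^sub>E UNIV. if f n = f 0 then ?F f else 0)"
  proof (intro sum.cong refl)
    fix f :: "nat \<Rightarrow> 'n"
    have "(\<Sum>p\<in>UNIV. if f 0 = p \<and> f n = p then ?F f else 0) =
      (\<Sum>p\<in>UNIV. if p = f 0 then if f n = p then ?F f else 0 else 0)"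
      by (intro sum.cong) auto
    then show "(\<Sum>p\<in>UNIV. if f 0 = p \<and> f n = p then ?F f else 0) =
        (if f n = f 0 then ?F f else 0)" by simp
  qed
  also have "\<dots> = (\<Sum>g\<in>{..<n} \<rightarrow>\<^sub>E UNIV. \<Sum>y\<in>UNIV. if y = g 0 then ?F (g(n := y)) else 0)"
  proof -
    have "{..n} = insert n {..<n}" by auto
    then show ?thesis using assms by (simp add: sum_PiE_insert)
  qed
  also have "\<dots> = (\<Sum>g\<in>{..<n} \<rightarrow>\<^sub>E UNIV. ?F (g(n := g 0)))"
    by simp
  also have "\<dots> = contraction {..<n} (\<lambda>i. Suc i mod n) M"
    unfolding contraction_def
  proof (intro sum.cong prod.cong refl)
    fix g :: "nat \<Rightarrow> 'n" and i assume "i \<in> {..<n}"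
    then show "M i $ (g(n := g 0)) i $ (g(n := g 0)) (Suc i) = M i $ g i $ g (Suc i mod n)"
      by (cases "Suc i = n") auto
  qed
  finally show ?thesis .
qed

lemma contraction_orbit:
  assumes "permutation \<sigma>"
  shows "contraction (orbit \<sigma> a) \<sigma> h =
    trace (matrix_prod_list (map h (map (\<lambda>n. (\<sigma> ^^ n) a) [0..<card (orbit \<sigma> a)])))"
proof -
  have self: "a \<in> orbit \<sigma> a" by (rule permutation_self_in_orbit[OF assms])
  \<comment> \<open>The first return time to \<open>a\<close>: on \<open>{..<n}\<close> the iterates
    of \<open>a\<close> enumerate the orbit once, and the cyclic shift corresponds to
    \<open>\<sigma>\<close>.\<close>
  define n where "n = funpow_dist1 \<sigma> a a"
  have n: "(\<sigma> ^^ n) a = a" "n > 0"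
    using funpow_dist1_prop[OF self] by (auto simp: n_def)
  have bij: "bij_betw (\<lambda>i. (\<sigma> ^^ i) a) {..<n} (orbit \<sigma> a)"
    unfolding bij_betw_def
  proof
    show "inj_on (\<lambda>i. (\<sigma> ^^ i) a) {..<n}"
      using inj_on_funpow_dist1[OF self] by (simp add: n_def lessThan_atLeast0)
    show "(\<lambda>i. (\<sigma> ^^ i) a) ` {..<n} = orbit \<sigma> a"
      using orbit_altdef_bounded[OF n] by auto
  qed
  then have card: "card (orbit \<sigma> a) = n" using bij_betw_same_card by force
  have "\<sigma> ((\<sigma> ^^ i) a) = (\<sigma> ^^ (Suc i mod n)) a" for i
    using funpow_mod_eq[OF n(1), of "Suc i"] by simp
  then have "contraction (orbit \<sigma> a) \<sigma> h =
      contraction {..<n} (\<lambda>i. Suc i mod n) (h \<circ> (\<lambda>i. (\<sigma> ^^ i) a))"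
    using n(2) by (intro contraction_reindex[OF bij]) auto
  also have "\<dots> = trace (matrix_prod_list (map (h \<circ> (\<lambda>i. (\<sigma> ^^ i) a)) [0..<n]))"
    by (rule trace_matrix_prod_list[OF n(2), symmetric])
  finally show ?thesis by (simp add: card)
qed

text \<open>The orbits partition the arcs, so the contraction factors into one trace per orbit. A
  contraction singles out no starting arc, which makes the representative picked by
  \<open>SOME\<close> irrelevant.\<close>

lemma wilson_function_eq_contraction:
  assumes fin: "finite (arcs L)" and perm: "next_arc L S permutes arcs L"
  shows "wilson_function L S = contraction (arcs L) (next_arc L S)"
proof
  fix h :: "(real^3) set \<Rightarrow> complex^'n^('n::finite)"
  let ?\<sigma> = "next_arc L S" and ?P = "orbit (next_arc L S) ` arcs L"
  have p: "permutation ?\<sigma>" using fin perm by (auto simp: permutation_permutes)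
  have self: "\<And>a. a \<in> orbit ?\<sigma> a" by (rule permutation_self_in_orbit[OF p])
  have eq: "orbit ?\<sigma> b = orbit ?\<sigma> a" if "b \<in> orbit ?\<sigma> a" for a b
    using that orbit_swap[OF self that] by (auto intro: orbit_trans)
  have sub: "orbit ?\<sigma> a \<subseteq> arcs L" if "a \<in> arcs L" for a
    by (rule permutes_orbit_subset[OF perm that])
  have Un: "\<Union>?P = arcs L" using self sub by auto
  have "contraction (\<Union>?P) ?\<sigma> h = (\<Prod>c\<in>?P. contraction c ?\<sigma> h)"
  proof (rule contraction_Union)
    show "finite ?P" using fin by simp
    show "finite c" if c: "c \<in> ?P" for c
    proof -
      from c obtain a where "a \<in> arcs L" "c = orbit ?\<sigma> a" by blast
      then show ?thesis using finite_subset[OF sub fin] by blast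
    qed
    show "?\<sigma> x \<in> c" if "c \<in> ?P" "x \<in> c" for c x
      using that by (auto intro: orbit.step)
    show "pairwise disjnt ?P"
    proof (rule pairwiseI, rule ccontr)
      fix c d assume cd: "c \<in> ?P" "d \<in> ?P" "c \<noteq> d" "\<not> disjnt c d"
      then obtain x where "x \<in> c" "x \<in> d" by (auto simp: disjnt_def)
      moreover obtain a b where "c = orbit ?\<sigma> a" "d = orbit ?\<sigma> b" using cd(1,2) by blast
      ultimately have "c = d" using eq[of x a] eq[of x b] by simp
      with cd(3) show False by simp
    qed
  qed
  also have "\<dots> = wilson_function L S h"
    unfolding wilson_function_def
  proof (intro prod.cong refl)
    fix c assume c: "c \<in> ?P"
    then obtain a where a: "c = orbit ?\<sigma> a" by blast
    then have "a \<in> c" using self by simp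
    then have "(SOME a. a \<in> c) \<in> c" by (rule someI)
    then have "orbit ?\<sigma> (SOME a. a \<in> c) = c" unfolding a by (rule eq)
    then show "contraction c ?\<sigma> h = trace (matrix_prod_list (map h (cycle_from L S (SOME a. a \<in> c))))"
      by (metis contraction_orbit[OF p] cycle_from_def)
  qed
  finally show "wilson_function L S h = contraction (arcs L) ?\<sigma> h" by (simp only: Un)
qed

subsection \<open>Functional derivatives of contractions\<close>

text \<open>\<open>M a\<close> is the matrix sitting at the junction between \<open>a\<close> and
  \<open>\<sigma> a\<close>. Insertions at crossings only change these junction matrices, so
  iterated derivatives of Wilson loops remain combinations of such functions.\<close>

definition dressed ::
    "'a set \<Rightarrow> ('a \<Rightarrow> 'a) \<Rightarrow> ('a \<Rightarrow> complex^'n^'n) \<Rightarrow> ('a \<Rightarrow> complex^'n^('n::finite)) \<Rightarrow> complex" where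
  "dressed X \<sigma> M = (\<lambda>h. contraction X \<sigma> (\<lambda>a. h a ** M a))"

lemma dressed_one: "dressed X \<sigma> (\<lambda>_. mat 1) = contraction X \<sigma>"
  by (simp add: dressed_def fun_eq_iff)

section \<open>Polynomial functions and their derivations\<close>

lemma poly_functions_sum:
  assumes "finite I" "\<And>j. j \<in> I \<Longrightarrow> F j \<in> poly_functions X"
  shows "(\<lambda>h. \<Sum>j\<in>I. F j h) \<in> poly_functions X"
  using assms by (induction I rule: finite_induct) (auto intro: poly_functions.intros)

lemma poly_functions_prod:
  assumes "finite I" "\<And>j. j \<in> I \<Longrightarrow> F j \<in> poly_functions X"
  shows "(\<lambda>h. \<Prod>j\<in>I. F j h) \<in> poly_functions X"
  using assms by (induction I rule: finite_induct) (auto intro: poly_functions.intros)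

lemma poly_functions_scale:
  "F \<in> poly_functions X \<Longrightarrow> (\<lambda>h. c * F h) \<in> poly_functions X"
  by (rule poly_functions.mult[OF poly_functions.const])

lemma dressed_in_poly_functions:
  assumes "finite X"
  shows "dressed X \<sigma> M \<in> poly_functions X"
  unfolding dressed_def contraction_def matrix_matrix_mult_def vec_lambda_beta using assms
  by (intro poly_functions_sum poly_functions_prod finite_PiE poly_functions.mult
      poly_functions.entry poly_functions.const) auto

lemma derivation_onD:
  assumes "derivation_on P d" "F \<in> P"
  shows "d F \<in> P"
    and "G \<in> P \<Longrightarrow> d (\<lambda>h. F h + G h) = (\<lambda>h. d F h + d G h)"
    and "d (\<lambda>h. c * F h) = (\<lambda>h. c * d F h)"
    and "G \<in> P \<Longrightarrow> d (\<lambda>h. F h * G h) = (\<lambda>h. d F h * G h + F h * d G h)"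
  using assms unfolding derivation_on_def by simp_all

text \<open>From 1 = 1 * 1 the product rule gives \<open>d 1 = 2 * d 1\<close>; every other constant
  is a multiple of 1.\<close>

lemma derivation_on_const:
  assumes "derivation_on (poly_functions X) d"
  shows "d (\<lambda>h. c) = (\<lambda>h. 0)"
proof -
  note D = derivation_onD[OF assms poly_functions.const[of 1]]
  have "d (\<lambda>h. 1) h = d (\<lambda>h. 1) h + d (\<lambda>h. 1) h" for h
    using D(4)[OF poly_functions.const[of 1]] by (simp add: fun_eq_iff)
  then have "d (\<lambda>h. 1) h = 0" for h by (metis add_cancel_right_right)
  then show ?thesis using D(3)[of c] by simp
qed

text \<open>Constants and entries generate the polynomial functions under sums and products. This is
  the uniqueness half of the description by \<open>THE\<close> in \<open>insertion\<close>.\<close>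

lemma derivation_on_unique:
  assumes d: "derivation_on (poly_functions X) d" "derivation_on (poly_functions X) d'"
    and entries: "\<And>a r s. a \<in> X \<Longrightarrow> d (\<lambda>h. h a $ r $ s) = d' (\<lambda>h. h a $ r $ s)"
    and F: "F \<in> poly_functions X"
  shows "d F = d' F"
  using F
proof (induction rule: poly_functions.induct)
  case (const c)
  then show ?case using d by (simp add: derivation_on_const)
next
  case (entry a r s)
  then show ?case by (rule entries)
next
  case (add F G)
  then show ?case by (simp add: d[THEN derivation_onD(2)])
next
  case (mult F G)
  then show ?case by (simp add: d[THEN derivation_onD(4)])
qed

text \<open>The directional derivative along the vector field \<open>V\<close>, in a complex
  parameter \<open>t\<close>. It provides the existence half: a concrete derivation with prescribed
  values on the entries.\<close>

definition line_deriv ::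
    "('n assignment \<Rightarrow> 'n assignment) \<Rightarrow> ('n::finite) arc_function \<Rightarrow> 'n arc_function" where
  "line_deriv V F = (\<lambda>h. deriv (\<lambda>t. F (\<lambda>a. \<chi> r s. h a $ r $ s + t * V h a $ r $ s)) 0)"

lemma line_deriv_eqI:
  assumes "\<And>h. ((\<lambda>t. F (\<lambda>a. \<chi> r s. h a $ r $ s + t * V h a $ r $ s)) has_field_derivative G h) (at 0)"
  shows "line_deriv V F = G"
  using assms by (auto simp: line_deriv_def intro!: DERIV_imp_deriv)

lemma poly_functions_has_line_deriv:
  assumes "F \<in> poly_functions X"
  shows "((\<lambda>t. F (\<lambda>a. \<chi> r s. h a $ r $ s + t * V h a $ r $ s))
    has_field_derivative line_deriv V F h) (at 0)"
proof -
  have "(\<lambda>t. F (\<lambda>a. \<chi> r s. h a $ r $ s + t * V h a $ r $ s)) field_differentiable at 0"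
    using assms by (induction rule: poly_functions.induct) (auto intro!: derivative_intros)
  then show ?thesis
    by (simp add: line_deriv_def DERIV_deriv_iff_field_differentiable)
qed

lemma line_deriv_simps:
  shows "line_deriv V (\<lambda>h. c) = (\<lambda>h. 0)"
    and "line_deriv V (\<lambda>h. h a $ r $ s) = (\<lambda>h. V h a $ r $ s)"
    and "F \<in> poly_functions X \<Longrightarrow> G \<in> poly_functions X \<Longrightarrow>
      line_deriv V (\<lambda>h. F h + G h) = (\<lambda>h. line_deriv V F h + line_deriv V G h)"
    and "F \<in> poly_functions X \<Longrightarrow> G \<in> poly_functions X \<Longrightarrow>
      line_deriv V (\<lambda>h. F h * G h) = (\<lambda>h. line_deriv V F h * G h + F h * line_deriv V G h)"
  by (rule line_deriv_eqI;
      auto intro!: derivative_eq_intros poly_functions_has_line_deriv)+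

text \<open>Polynomial entries of \<open>V\<close> keep the derivative inside the polynomial
  functions; \<open>restrict\<close> supplies the extensionality demanded in
  \<open>insertion\<close>.\<close>

lemma derivation_on_line_deriv:
  assumes V: "\<And>a r s. a \<in> X \<Longrightarrow> (\<lambda>h. V h a $ r $ s) \<in> poly_functions X"
  shows "derivation_on (poly_functions X) (restrict (line_deriv V) (poly_functions X))"
proof -
  have mem: "line_deriv V F \<in> poly_functions X" if "F \<in> poly_functions X" for F
    using that
  proof (induction rule: poly_functions.induct)
    case (add F G)
    then show ?case by (simp add: line_deriv_simps(3)[of _ X] poly_functions.add)
  next
    case (mult F G)
    then show ?case
      by (auto simp: line_deriv_simps(4)[of _ X] intro!: poly_functions.add poly_functions.mult)
  qed (auto simp: line_deriv_simps V intro: poly_functions.const)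
  have "line_deriv V (\<lambda>h. c * F h) = (\<lambda>h. c * line_deriv V F h)"
    if "F \<in> poly_functions X" for F c
    using line_deriv_simps(4)[OF poly_functions.const that, of V c]
    by (simp add: line_deriv_simps(1))
  then show ?thesis
    unfolding derivation_on_def
    by (auto simp: mem poly_functions.add poly_functions.mult poly_functions_scale
        line_deriv_simps(3,4)[of _ X])
qed

definition insertion_field ::
    "'a \<Rightarrow> 'a \<Rightarrow> complex^'n^'n \<Rightarrow> ('a \<Rightarrow> complex^'n^('n::finite)) \<Rightarrow> 'a \<Rightarrow> complex^'n^'n" where
  "insertion_field ain aout Y h a = (\<chi> r s.
     (if a = ain then (1/2) * (h a ** Y) $ r $ s else 0) +
     (if a = aout then (1/2) * (Y ** h a) $ r $ s else 0))"

lemma insertion_field_in_poly_functions: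
  assumes "a \<in> X"
  shows "(\<lambda>h. insertion_field ain aout Y h a $ r $ s) \<in> poly_functions X"
proof -
  have *: "(\<lambda>h. if c then F h else 0) \<in> poly_functions X" if "F \<in> poly_functions X" for c F
    using that by (cases c) (auto intro: poly_functions.const)
  show ?thesis
    unfolding insertion_field_def matrix_matrix_mult_def vec_lambda_beta
    by (intro * poly_functions.add poly_functions_scale poly_functions_sum poly_functions.mult
        poly_functions.const poly_functions.entry assms finite)
qed

text \<open>The directional derivative is a witness; any other candidate agrees with it on
  polynomial functions because the entries generate them, and elsewhere because both are
  extensional.\<close>

lemma insertion_eq_line_deriv:
  "insertion L i b Y =
     restrict (line_deriv (insertion_field (in_arc L i b) (out_arc L i b) Y)) (poly_functions (arcs L))"
    (is "_ = ?d")
  unfolding insertion_def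
proof (rule the_equality)
  let ?P = "poly_functions (arcs L) :: ('n::finite) arc_function set"
  have d: "derivation_on ?P ?d"
    by (intro derivation_on_line_deriv insertion_field_in_poly_functions)
  have e: "?d (\<lambda>h. h a $ r $ s) =
       (\<lambda>h. (if a = in_arc L i b then (1/2) * (h a ** Y) $ r $ s else 0) +
            (if a = out_arc L i b then (1/2) * (Y ** h a) $ r $ s else 0))"
    if "a \<in> arcs L" for a r s
    using that by (simp add: poly_functions.entry line_deriv_simps(2) insertion_field_def)
  show *: "?d \<in> extensional ?P \<and> derivation_on ?P ?d \<and>
     (\<forall>a\<in>arcs L. \<forall>r s. ?d (\<lambda>h. h a $ r $ s) =
       (\<lambda>h. (if a = in_arc L i b then (1/2) * (h a ** Y) $ r $ s else 0) +
            (if a = out_arc L i b then (1/2) * (Y ** h a) $ r $ s else 0)))"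
    using d e by blast
  show "d' = ?d" if d': "d' \<in> extensional ?P \<and> derivation_on ?P d' \<and>
     (\<forall>a\<in>arcs L. \<forall>r s. d' (\<lambda>h. h a $ r $ s) =
       (\<lambda>h. (if a = in_arc L i b then (1/2) * (h a ** Y) $ r $ s else 0) +
            (if a = out_arc L i b then (1/2) * (Y ** h a) $ r $ s else 0)))" for d'
  proof
    fix F
    show "d' F = ?d F"
    proof (cases "F \<in> ?P")
      case True
      show ?thesis
        by (rule derivation_on_unique[OF _ d _ True]) (use d' e in auto)
    next
      case False
      then show ?thesis using d' by (auto simp: extensional_def)
    qed
  qed
qed

lemma derivation_on_insertion:
  "derivation_on (poly_functions (arcs L)) (insertion L i b Y)"
  unfolding insertion_eq_line_deriv
  by (intro derivation_on_line_deriv insertion_field_in_poly_functions)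

lemma insertion_poly_functions:
  assumes "F \<in> poly_functions (arcs L)" "G \<in> poly_functions (arcs L)"
  shows "insertion L i b Y F \<in> poly_functions (arcs L)"
    and "insertion L i b Y (\<lambda>h. F h + G h) = (\<lambda>h. insertion L i b Y F h + insertion L i b Y G h)"
    and "insertion L i b Y (\<lambda>h. c * F h) = (\<lambda>h. c * insertion L i b Y F h)"
  using assms by (simp_all add: derivation_onD[OF derivation_on_insertion])

text \<open>Leibniz rule: one arc at a time is differentiated, and \<open>V h a ** M a\<close> takes
  the place of its dressed matrix.\<close>

lemma line_deriv_dressed:
  assumes fin: "finite X"
  shows "line_deriv V (dressed X \<sigma> M) =
    (\<lambda>h. \<Sum>a\<in>X. contraction X \<sigma> ((\<lambda>c. h c ** M c)(a := V h a ** M a)))"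
proof (rule line_deriv_eqI)
  fix h :: "'a assignment"
  let ?l = "\<lambda>t a. \<chi> r s. h a $ r $ s + t * V h a $ r $ s"
  have entry: "((\<lambda>t. (?l t a ** M a) $ p $ q) has_field_derivative (V h a ** M a) $ p $ q) (at 0)"
    for a p q
    unfolding matrix_matrix_mult_def vec_lambda_beta by (auto intro!: derivative_eq_intros)
  have "((\<lambda>t. \<Prod>a\<in>X. (?l t a ** M a) $ f a $ f (\<sigma> a)) has_field_derivative
     (\<Sum>a\<in>X. (V h a ** M a) $ f a $ f (\<sigma> a) * (\<Prod>c\<in>X - {a}. (h c ** M c) $ f c $ f (\<sigma> c)))) (at 0)" for f
    using has_field_derivative_prod[OF entry] by simp
  then have "((\<lambda>t. \<Sum>f\<in>X \<rightarrow>\<^sub>E UNIV. \<Prod>a\<in>X. (?l t a ** M a) $ f a $ f (\<sigma> a)) has_field_derivative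
     (\<Sum>f\<in>X \<rightarrow>\<^sub>E UNIV. \<Sum>a\<in>X. (V h a ** M a) $ f a $ f (\<sigma> a) *
        (\<Prod>c\<in>X - {a}. (h c ** M c) $ f c $ f (\<sigma> c)))) (at 0)"
    by (intro DERIV_sum)
  moreover have "(\<Sum>f\<in>X \<rightarrow>\<^sub>E UNIV. \<Sum>a\<in>X. (V h a ** M a) $ f a $ f (\<sigma> a) *
        (\<Prod>c\<in>X - {a}. (h c ** M c) $ f c $ f (\<sigma> c))) =
      (\<Sum>a\<in>X. contraction X \<sigma> ((\<lambda>c. h c ** M c)(a := V h a ** M a)))"
    by (subst sum.swap) (intro sum.cong refl, simp add: contraction_upd[OF fin])
  ultimately show "((\<lambda>t. dressed X \<sigma> M (?l t)) has_field_derivative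
      (\<Sum>a\<in>X. contraction X \<sigma> ((\<lambda>c. h c ** M c)(a := V h a ** M a)))) (at 0)"
    unfolding dressed_def contraction_def by simp
qed

lemma matrix_lincomb_mult:
  fixes A B :: "complex^'n^'m" and N :: "complex^'k^'n"
  shows "(\<chi> r s. c * A $ r $ s + d * B $ r $ s) ** N =
    (\<chi> r s. c * (A ** N) $ r $ s) + (\<chi> r s. d * (B ** N) $ r $ s)"
  by (simp add: vec_eq_iff matrix_matrix_mult_def distrib_right sum.distrib sum_distrib_left
      mult.assoc)

text \<open>The left multiplication \<open>Y ** h aout\<close> is slid across to the arc \<open>q\<close> preceding
  \<open>aout\<close> along \<open>\<sigma>\<close>, so that only right multiplications occur.\<close>

lemma insertion_dressed:
  fixes Y :: "complex^'n^('n::finite)"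
  assumes fin: "finite (arcs L)" and bij: "bij_betw \<sigma> (arcs L) (arcs L)"
    and ain: "in_arc L i b \<in> arcs L" and q: "q \<in> arcs L" "\<sigma> q = out_arc L i b"
  shows "insertion L i b Y (dressed (arcs L) \<sigma> M) =
    (\<lambda>h. 1/2 * dressed (arcs L) \<sigma> (M(in_arc L i b := Y ** M (in_arc L i b))) h +
         1/2 * dressed (arcs L) \<sigma> (M(q := M q ** Y)) h)"
proof
  fix h :: "'n assignment"
  let ?X = "arcs L" and ?ain = "in_arc L i b" and ?aout = "out_arc L i b"
  let ?k = "\<lambda>c. h c ** M c"
  have aout: "?aout \<in> ?X" using q bij by (auto simp: bij_betw_def)
  have "contraction ?X \<sigma> (?k(a := insertion_field ?ain ?aout Y h a ** M a)) =
      (if a = ?ain then 1/2 * contraction ?X \<sigma> (?k(a := h a ** Y ** M a)) else 0) +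
      (if a = ?aout then 1/2 * contraction ?X \<sigma> (?k(a := Y ** h a ** M a)) else 0)"
    if a: "a \<in> ?X" for a
  proof -
    have "insertion_field ?ain ?aout Y h a ** M a =
      (\<chi> r s. (if a = ?ain then 1/2 else 0) * (h a ** Y ** M a) $ r $ s) +
      (\<chi> r s. (if a = ?aout then 1/2 else 0) * (Y ** h a ** M a) $ r $ s)"
      unfolding matrix_lincomb_mult[symmetric] by (simp add: insertion_field_def vec_eq_iff)
    then show ?thesis
      by (simp add: contraction_upd_add[OF fin a]
          contraction_upd_scale[OF fin a, of _ "if a = ?ain then 1/2 else 0" "h a ** Y ** M a"]
          contraction_upd_scale[OF fin a, of _ "if a = ?aout then 1/2 else 0" "Y ** h a ** M a"])
  qed
  then have "insertion L i b Y (dressed ?X \<sigma> M) h =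
      1/2 * contraction ?X \<sigma> (?k(?ain := h ?ain ** Y ** M ?ain)) +
      1/2 * contraction ?X \<sigma> (?k(?aout := Y ** h ?aout ** M ?aout))"
    using ain aout fin
    by (simp add: insertion_eq_line_deriv dressed_in_poly_functions[OF fin] line_deriv_dressed
        sum.distrib sum.delta cong: if_cong)
  also have "contraction ?X \<sigma> (?k(?ain := h ?ain ** Y ** M ?ain)) =
      dressed ?X \<sigma> (M(?ain := Y ** M ?ain)) h"
    unfolding dressed_def by (intro contraction_cong) (auto simp: matrix_mul_assoc)
  also have "contraction ?X \<sigma> (?k(?aout := Y ** h ?aout ** M ?aout)) =
      contraction ?X \<sigma> (?k(\<sigma> q := Y ** ?k (\<sigma> q)))"
    using q by (intro contraction_cong) (auto simp: matrix_mul_assoc)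
  also have "\<dots> = contraction ?X \<sigma> (?k(q := ?k q ** Y))"
    by (rule contraction_slide[OF fin bij q(1)])
  also have "\<dots> = dressed ?X \<sigma> (M(q := M q ** Y)) h"
    unfolding dressed_def by (intro contraction_cong) (auto simp: matrix_mul_assoc)
  finally show "insertion L i b Y (dressed ?X \<sigma> M) h =
      1/2 * dressed ?X \<sigma> (M(?ain := Y ** M ?ain)) h + 1/2 * dressed ?X \<sigma> (M(q := M q ** Y)) h" .
qed

subsection \<open>The completeness relation of su(2)\<close>

text \<open>These are \<open>\<i>\<close> times the Pauli matrices, in the order third, second,
  first. They are orthogonal for the trace form, with
  \<open>trace (su2_basis a ** su2_basis a) = - 2\<close>.\<close>

definition su2_basis :: "3 \<Rightarrow> complex^2^2" where
  "su2_basis a =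
     (if a = 1 then vector [vector [\<i>, 0], vector [0, - \<i>]]
      else if a = 2 then vector [vector [0, 1], vector [- 1, 0]]
      else vector [vector [0, \<i>], vector [\<i>, 0]])"

lemma su2_basis_in_su: "su2_basis a \<in> su"
  using exhaust_3[of a]
  by (auto simp: su_def su2_basis_def vec_eq_iff forall_2 trace_def sum_2 vector_2)

text \<open>The factor -1/2 is the inverse of the Gram value -2; the identity is then checked on all
  16 index combinations.\<close>

lemma su2_basis_fierz:
  "(\<Sum>a\<in>UNIV. - 1/2 * (su2_basis a $ p $ q * su2_basis a $ r $ s)) =
    (if p = s \<and> q = r then 1 else 0) - 1/2 * (if p = q \<and> r = s then 1 else 0)"
proof -
  have "\<forall>p q r s. (\<Sum>a\<in>UNIV. - 1/2 * (su2_basis a $ p $ q * su2_basis a $ r $ s)) =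
    (if p = s \<and> q = r then 1 else 0) - 1/2 * (if p = q \<and> r = s then 1 else 0)"
    unfolding forall_2 sum_3 su2_basis_def by simp
  then show ?thesis by blast
qed

text \<open>A traceless skew-Hermitian 2 by 2 matrix has three real parameters, read off from its
  first row. The trace pairing recovers each of them up to the factor -2, by orthogonality of the
  basis.\<close>

lemma su2_expansion:
  assumes "X \<in> (su :: (complex^2^2) set)"
  obtains d :: "3 \<Rightarrow> real" where "X = (\<Sum>a\<in>UNIV. d a *\<^sub>R su2_basis a)"
    and "\<And>a. trace (X ** su2_basis a) = - 2 * of_real (d a)"
proof -
  have "X $ 1 $ 1 + X $ 2 $ 2 = 0"
    using assms by (simp add: su_def trace_def sum_2)
  then have tr: "X $ 2 $ 2 = - X $ 1 $ 1" by (rule minus_unique[symmetric])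
  have "cnj (X $ 1 $ 1) = - X $ 1 $ 1" "cnj (X $ 2 $ 1) = - X $ 1 $ 2"
    using assms by (auto simp: su_def vec_eq_iff forall_2)
  then have X: "Re (X $ 1 $ 1) = 0" "Re (X $ 2 $ 1) = - Re (X $ 1 $ 2)" "Im (X $ 2 $ 1) = Im (X $ 1 $ 2)"
    by (auto simp: complex_eq_iff)
  define d :: "3 \<Rightarrow> real" where
    "d a = (if a = 1 then Im (X $ 1 $ 1) else if a = 2 then Re (X $ 1 $ 2) else Im (X $ 1 $ 2))" for a
  show ?thesis
  proof
    show "X = (\<Sum>a\<in>UNIV. d a *\<^sub>R su2_basis a)"
      by (auto simp: vec_eq_iff forall_2 sum_3 su2_basis_def vector_2 d_def complex_eq_iff X tr)
    show "trace (X ** su2_basis a) = - 2 * of_real (d a)" for a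
      using exhaust_3[of a]
      by (auto simp: trace_def sum_2 matrix_matrix_mult_def su2_basis_def vector_2 d_def
          complex_eq_iff X tr)
  qed
qed

text \<open>The tensor built from a basis and its inverse Gram matrix does not depend on the basis,
  so it can be evaluated in \<open>su2_basis\<close>. The real matrices \<open>c\<close> and
  \<open>d\<close> express either basis in the other.\<close>

lemma fierz_su2:
  fixes e :: "'b::finite \<Rightarrow> complex^2^2"
  assumes inj: "inj e" and ind: "independent (range e)" and span: "span (range e) = su"
  shows "fierz (1/2) (\<lambda>\<alpha> \<beta>. matrix_inv (gram e) $ \<alpha> $ \<beta>) e"
proof -
  have "\<exists>c. su2_basis a = (\<Sum>\<alpha>\<in>UNIV. c \<alpha> *\<^sub>R e \<alpha>)" for a
  proof -
    have "su2_basis a \<in> span (range e)" using su2_basis_in_su span by simp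
    then obtain u where "su2_basis a = (\<Sum>v\<in>range e. u v *\<^sub>R v)"
      by (auto simp: span_finite)
    then show ?thesis using inj by (auto simp: sum.reindex)
  qed
  then obtain c where c: "\<And>a. su2_basis a = (\<Sum>\<alpha>\<in>UNIV. c a \<alpha> *\<^sub>R e \<alpha>)" by metis
  have "\<exists>d. e \<alpha> = (\<Sum>a\<in>UNIV. d a *\<^sub>R su2_basis a) \<and>
      (\<forall>a. trace (e \<alpha> ** su2_basis a) = - 2 * of_real (d a))" for \<alpha>
  proof -
    have "e \<alpha> \<in> su" unfolding span[symmetric] by (simp add: span_base)
    then show ?thesis by (metis su2_expansion)
  qed
  then obtain d where d: "\<And>\<alpha>. e \<alpha> = (\<Sum>a\<in>UNIV. d \<alpha> a *\<^sub>R su2_basis a)"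
    "\<And>\<alpha> a. trace (e \<alpha> ** su2_basis a) = - 2 * of_real (d \<alpha> a)" by metis
  have dc: "(\<Sum>a\<in>UNIV. d \<alpha> a * c a \<gamma>) = (if \<alpha> = \<gamma> then 1 else 0)" for \<alpha> \<gamma>
  proof -
    \<comment> \<open>The row of \<open>d c - 1\<close> at \<open>\<alpha>\<close>. Its entries are
      the coefficients of a linear relation among the \<open>e \<gamma>\<close>, so independence
      makes them vanish.\<close>
    define x where "x = (\<lambda>\<gamma>. (\<Sum>a\<in>UNIV. d \<alpha> a * c a \<gamma>) - (if \<alpha> = \<gamma> then 1 else 0))"
    have "e \<alpha> = (\<Sum>a\<in>UNIV. \<Sum>\<gamma>\<in>UNIV. (d \<alpha> a * c a \<gamma>) *\<^sub>R e \<gamma>)"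
      by (subst d(1)) (simp add: c scaleR_sum_right)
    also have "\<dots> = (\<Sum>\<gamma>\<in>UNIV. (\<Sum>a\<in>UNIV. d \<alpha> a * c a \<gamma>) *\<^sub>R e \<gamma>)"
      by (subst sum.swap) (simp add: scaleR_sum_left)
    finally have eq: "(\<Sum>\<gamma>\<in>UNIV. (\<Sum>a\<in>UNIV. d \<alpha> a * c a \<gamma>) *\<^sub>R e \<gamma>) = e \<alpha>"
      by (rule sym)
    have "(if \<alpha> = \<gamma> then 1 else 0) *\<^sub>R e \<gamma> = (if \<alpha> = \<gamma> then e \<gamma> else 0)" for \<gamma>
      by simp
    then have "(\<Sum>\<gamma>\<in>UNIV. x \<gamma> *\<^sub>R e \<gamma>) = 0"
      by (simp add: x_def scaleR_diff_left sum_subtractf eq)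
    then have sum0: "(\<Sum>v\<in>range e. x (the_inv e v) *\<^sub>R v) = 0"
      using inj by (simp add: sum.reindex the_inv_f_f)
    have "x (the_inv e (e \<gamma>)) = 0"
      by (rule real_vector.independentD[OF ind _ subset_refl sum0]) auto
    then have "x \<gamma> = 0" using inj by (simp add: the_inv_f_f)
    then show ?thesis by (simp add: x_def)
  qed
  have c_entry: "su2_basis a $ p $ q = (\<Sum>\<alpha>\<in>UNIV. of_real (c a \<alpha>) * e \<alpha> $ p $ q)" for a p q
    unfolding c sum_component vector_scaleR_component by (simp add: scaleR_conv_of_real)
  \<comment> \<open>The inverse Gram matrix of \<open>su2_basis\<close>, which is -1/2 times the
    identity, transported by \<open>c\<close>.\<close>
  define G :: "complex^'b^'b" where
    "G = (\<chi> \<alpha> \<beta>. \<Sum>a\<in>UNIV. - 1/2 * (of_real (c a \<alpha>) * of_real (c a \<beta>)))"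
  have tr: "(\<Sum>\<beta>\<in>UNIV. trace (X ** e \<beta>) * of_real (c a \<beta>)) = trace (X ** su2_basis a)" for X a
  proof -
    have "trace (X ** su2_basis a) =
      (\<Sum>i\<in>UNIV. \<Sum>k\<in>UNIV. \<Sum>\<beta>\<in>UNIV. X $ i $ k * e \<beta> $ k $ i * of_real (c a \<beta>))"
      unfolding trace_def matrix_matrix_mult_def
      by (simp add: c_entry sum_distrib_left mult_ac)
    also have "\<dots> = (\<Sum>\<beta>\<in>UNIV. \<Sum>i\<in>UNIV. \<Sum>k\<in>UNIV. X $ i $ k * e \<beta> $ k $ i * of_real (c a \<beta>))"
      by (rule sum_rotate)
    finally show ?thesis by (simp add: trace_def matrix_matrix_mult_def sum_distrib_right)
  qed
  have "(gram e ** G) $ \<alpha> $ \<gamma> = mat 1 $ \<alpha> $ \<gamma>" for \<alpha> \<gamma>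
  proof -
    have "(gram e ** G) $ \<alpha> $ \<gamma> = (\<Sum>\<beta>\<in>UNIV. \<Sum>a\<in>UNIV.
        - 1/2 * of_real (c a \<gamma>) * (trace (e \<alpha> ** e \<beta>) * of_real (c a \<beta>)))"
      unfolding matrix_matrix_mult_def[of "gram e" G] vec_lambda_beta
      unfolding gram_def G_def vec_lambda_beta sum_distrib_left
      by (intro sum.cong refl) (simp add: mult_ac)
    also have "\<dots> = (\<Sum>a\<in>UNIV. - 1/2 * of_real (c a \<gamma>) * trace (e \<alpha> ** su2_basis a))"
      by (subst sum.swap) (simp only: sum_distrib_left[symmetric] tr)
    also have "\<dots> = of_real (\<Sum>a\<in>UNIV. d \<alpha> a * c a \<gamma>)"
      by (simp add: d(2) mult.commute)
    finally show ?thesis by (simp add: dc mat_def)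
  qed
  then have 1: "gram e ** G = mat 1" by (simp add: vec_eq_iff)
  then have 2: "G ** gram e = mat 1" by (simp add: matrix_left_right_inverse)
  have "matrix_inv (gram e) = G"
  proof -
    have "\<exists>A'. gram e ** A' = mat 1 \<and> A' ** gram e = mat 1" using 1 2 by blast
    then have "gram e ** matrix_inv (gram e) = mat 1" unfolding matrix_inv_def by (rule someI2_ex) auto
    then have "G ** (gram e ** matrix_inv (gram e)) = G" by simp
    then show ?thesis by (simp add: matrix_mul_assoc 2)
  qed
  moreover have "(\<Sum>\<alpha>\<in>UNIV. \<Sum>\<beta>\<in>UNIV. G $ \<alpha> $ \<beta> * (e \<alpha> $ p $ q * e \<beta> $ r $ s)) =
      (\<Sum>a\<in>UNIV. - 1/2 * (su2_basis a $ p $ q * su2_basis a $ r $ s))" for p q r s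
  proof -
    have "(\<Sum>\<alpha>\<in>UNIV. \<Sum>\<beta>\<in>UNIV. G $ \<alpha> $ \<beta> * (e \<alpha> $ p $ q * e \<beta> $ r $ s)) =
      (\<Sum>\<alpha>\<in>UNIV. \<Sum>\<beta>\<in>UNIV. \<Sum>a\<in>UNIV.
        - 1/2 * ((of_real (c a \<alpha>) * e \<alpha> $ p $ q) * (of_real (c a \<beta>) * e \<beta> $ r $ s)))"
      unfolding G_def vec_lambda_beta sum_distrib_right
      by (intro sum.cong refl) (simp add: mult_ac)
    also have "\<dots> = (\<Sum>a\<in>UNIV. \<Sum>\<alpha>\<in>UNIV. \<Sum>\<beta>\<in>UNIV.
        - 1/2 * ((of_real (c a \<alpha>) * e \<alpha> $ p $ q) * (of_real (c a \<beta>) * e \<beta> $ r $ s)))"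
      by (rule sum_rotate)
    also have "\<dots> = (\<Sum>a\<in>UNIV. - 1/2 * ((\<Sum>\<alpha>\<in>UNIV. of_real (c a \<alpha>) * e \<alpha> $ p $ q) *
        (\<Sum>\<beta>\<in>UNIV. of_real (c a \<beta>) * e \<beta> $ r $ s)))"
      unfolding sum_product by (simp only: sum_distrib_left)
    finally show ?thesis unfolding c_entry .
  qed
  ultimately show ?thesis unfolding fierz_def by (auto simp only: su2_basis_fierz)
qed

subsection \<open>The arcs of a link in general position\<close>

text \<open>The remaining members form a finite union of closed sets, so each member is open as well
  as closed in \<open>X\<close>; a nonempty connected clopen set is a component.\<close>

lemma components_eq_closed_partition:
  fixes X :: "'a::topological_space set"
  assumes fin: "finite \<F>" and Un: "\<Union>\<F> = X" and disj: "pairwise disjnt \<F>"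
    and C: "\<And>C. C \<in> \<F> \<Longrightarrow> connected C \<and> C \<noteq> {} \<and> closedin (top_of_set X) C"
  shows "components X = \<F>"
proof -
  have sub: "C \<in> components X" if "C \<in> \<F>" for C
  proof -
    have "closedin (top_of_set X) (\<Union>(\<F> - {C}))"
      using fin C by (intro closedin_Union) auto
    moreover have "X - \<Union>(\<F> - {C}) = C"
      using Un disj that unfolding pairwise_def disjnt_def by blast
    ultimately have op: "openin (top_of_set X) C"
      by (metis closedin_def topspace_euclidean_subtopology)
    have "D = C" if D: "C \<subseteq> D" "D \<subseteq> X" "connected D" for D
    proof -
      have "openin (top_of_set D) C" "closedin (top_of_set D) C"
        using op C[OF \<open>C \<in> \<F>\<close>] D by (auto intro: openin_subset_trans closedin_subset_trans)
      then show ?thesis using D(3) C[OF \<open>C \<in> \<F>\<close>] unfolding connected_clopen by blast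
    qed
    then show ?thesis unfolding in_components_maximal using C[OF that] Un that by blast
  qed
  moreover have "E \<in> \<F>" if E: "E \<in> components X" for E
  proof -
    obtain x where x: "x \<in> E" using in_components_nonempty[OF E] by blast
    then have "x \<in> \<Union>\<F>" using in_components_subset[OF E] Un by blast
    then obtain C where "C \<in> \<F>" "x \<in> C" by blast
    then show ?thesis using components_eq[OF E sub[of C]] x by blast
  qed
  ultimately show ?thesis by blast
qed

definition cuts :: "link \<Rightarrow> nat \<Rightarrow> real set" where
  "cuts L j = {r. curve L j r \<in> removed_points L}"

text \<open>Two consecutive cuts on the universal cover of the circle. An arc with ends fixes its
  interval up to integer translation; with a single cut per period the interval has length
  1.\<close>

definition gap :: "link \<Rightarrow> nat \<Rightarrow> real \<Rightarrow> real \<Rightarrow> bool" where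
  "gap L j a b \<longleftrightarrow> j \<in> {1..ncomp L} \<and> a \<in> cuts L j \<and> b \<in> cuts L j \<and> a < b \<and>
     {a<..<b} \<inter> cuts L j = {}"

lemma gap_unique:
  assumes "gap L j a b" "gap L j a' b'" "r \<in> {a<..<b}" "r \<in> {a'<..<b'}"
  shows "a = a'" "b = b'"
  using assms unfolding gap_def disjoint_iff greaterThanLessThan_iff
  by (meson less_trans linorder_neqE)+

section \<open>Parameters of the removed points\<close>

locale generic_link =
  fixes L :: link
  assumes general_position: "link_in_general_position L"
begin

abbreviation crossings :: "nat set" where "crossings \<equiv> {1..ncross L}"

abbreviation comps :: "nat set" where "comps \<equiv> {1..ncomp L}"

lemma continuous_on_curve:
  assumes "j \<in> comps"
  shows "continuous_on A (curve L j)"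
proof -
  have "smooth_curve (curve L j)"
    using general_position assms by (auto simp: link_in_general_position_def smooth_link_def)
  then obtain D where "D 0 = curve L j" "\<And>n s. (D n has_vector_derivative D (Suc n) s) (at s)"
    unfolding smooth_curve_def by blast
  then have "isCont (curve L j) s" for s
    by (metis has_vector_derivative_continuous)
  then show ?thesis by (simp add: continuous_at_imp_continuous_on)
qed

lemma curve_shift:
  assumes "j \<in> comps"
  shows "curve L j (s + of_int n) = curve L j s"
proof -
  have per: "curve L j (s + 1) = curve L j s" for s
    using general_position assms by (auto simp: link_in_general_position_def smooth_link_def)
  show ?thesis
  proof (induction n rule: int_induct[where k = 0])
    case (step1 n)
    then show ?case using per[of "s + of_int n"] by (simp add: add.assoc)
  next
    case (step2 n)
    then show ?case using per[of "s + of_int (n - 1)"] by (simp add: add.assoc)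
  qed simp
qed

lemma curve_frac:
  assumes "j \<in> comps"
  shows "curve L j (frac r) = curve L j r"
  using curve_shift[OF assms, of "frac r" "\<lfloor>r\<rfloor>"] by (simp add: frac_def)

text \<open>Injectivity is given on one period; reducing both parameters by \<open>frac\<close>
  leaves an integer ambiguity.\<close>

lemma curve_eqD:
  assumes "j \<in> comps" "j' \<in> comps" "curve L j r = curve L j' r'"
  shows "j' = j" "\<exists>n::int. r' = r + of_int n"
proof -
  have inj: "inj_on (point_at L) (params L)"
    using general_position by (auto simp: link_in_general_position_def smooth_link_def)
  have "point_at L (j, frac r) = point_at L (j', frac r')"
    using assms by (simp add: point_at_def curve_frac)
  moreover have "(j, frac r) \<in> params L" "(j', frac r') \<in> params L"
    using assms by (auto simp: params_def frac_lt_1)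
  ultimately have eq: "(j, frac r) = (j', frac r')" using inj by (meson inj_onD)
  then show "j' = j" by simp
  have "r' = r + of_int (\<lfloor>r'\<rfloor> - \<lfloor>r\<rfloor>)" using eq by (simp add: frac_def)
  then show "\<exists>n::int. r' = r + of_int n" ..
qed

lemma bij_betw_dpoint: "bij_betw (dpoint L) crossings {y. card (fibre L y) = 2}"
  using general_position
  unfolding link_in_general_position_def labelled_double_points_def by (elim conjE)

lemma fibre_dpoint:
  assumes "i \<in> crossings"
  shows "fibre L (dpoint L i) = {cpt L i True, cpt L i False}"
  using general_position assms
  unfolding link_in_general_position_def labelled_double_points_def by (elim conjE) (drule (1) bspec, elim conjE)

lemma cpt_in_fibre: "i \<in> crossings \<Longrightarrow> cpt L i b \<in> fibre L (dpoint L i)"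
  by (cases b) (simp_all add: fibre_dpoint)

lemma cpt_in_params: "i \<in> crossings \<Longrightarrow> cpt L i b \<in> params L"
  using cpt_in_fibre[of i b] by (simp add: fibre_def)

text \<open>Distinct crossings have distinct double points, and a fibre with two elements forces its
  two labels apart.\<close>

lemma cpt_inj:
  assumes i: "i \<in> crossings" "i' \<in> crossings" and eq: "cpt L i b = cpt L i' b'"
  shows "i = i' \<and> b = b'"
proof -
  have "dpoint L i = dpoint L i'"
    using cpt_in_fibre[OF i(1), of b] cpt_in_fibre[OF i(2), of b'] eq by (simp add: fibre_def)
  then have ii: "i = i'" using bij_betw_imp_inj_on[OF bij_betw_dpoint] i by (meson inj_onD)
  have "card {cpt L i True, cpt L i False} = 2"
    using bij_betw_apply[OF bij_betw_dpoint i(1)] fibre_dpoint[OF i(1)] by simp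
  then have "cpt L i True \<noteq> cpt L i False" by force
  then have "b = b'" using eq ii by (cases b; cases b') auto
  with ii show ?thesis by simp
qed

lemma finite_removed_points: "finite (removed_points L)"
proof -
  have "removed_points L = (\<lambda>(i, b). point_at L (cpt L i b)) ` (crossings \<times> UNIV)"
    by (auto simp: removed_points_def)
  then show ?thesis by simp
qed

lemma cuts_iff:
  assumes "j \<in> comps"
  shows "r \<in> cuts L j \<longleftrightarrow> (\<exists>i\<in>crossings. \<exists>b. cpt L i b = (j, frac r))"
proof
  assume "r \<in> cuts L j"
  then obtain i b where i: "i \<in> crossings" and eq: "curve L j r = point_at L (cpt L i b)"
    by (auto simp: cuts_def removed_points_def)
  obtain j' s where c: "cpt L i b = (j', s)" by fastforce
  have p: "j' \<in> comps" "0 \<le> s" "s < 1" using cpt_in_params[OF i, of b] c by (auto simp: params_def)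
  have "curve L j r = curve L j' s" using eq c by (simp add: point_at_def)
  then obtain n :: int where "j' = j" "s = r + of_int n" using curve_eqD[OF assms p(1)] by blast
  moreover from this have "frac r = s" using p by (simp add: frac_unique_iff)
  ultimately have "cpt L i b = (j, frac r)" using c by simp
  then show "\<exists>i\<in>crossings. \<exists>b. cpt L i b = (j, frac r)" using i by blast
next
  assume "\<exists>i\<in>crossings. \<exists>b. cpt L i b = (j, frac r)"
  then obtain i b where "i \<in> crossings" "cpt L i b = (j, frac r)" by blast
  then have "point_at L (cpt L i b) = curve L j r" by (simp add: point_at_def curve_frac[OF assms])
  with \<open>i \<in> crossings\<close> have "curve L j r \<in> removed_points L"
    unfolding removed_points_def by (metis (mono_tags, lifting) mem_Collect_eq)
  then show "r \<in> cuts L j" by (simp add: cuts_def)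
qed

lemma cuts_shift:
  assumes "j \<in> comps"
  shows "r + of_int n \<in> cuts L j \<longleftrightarrow> r \<in> cuts L j"
  by (simp add: cuts_def curve_shift[OF assms])

lemma finite_cuts:
  assumes "j \<in> comps"
  shows "finite (cuts L j \<inter> {r..<r + 1})"
proof -
  have "inj_on (curve L j) {r..<r + 1}"
  proof (rule inj_onI)
    fix s s' assume s: "s \<in> {r..<r + 1}" "s' \<in> {r..<r + 1}" "curve L j s = curve L j s'"
    then obtain n :: int where n: "s' = s + of_int n" using curve_eqD[OF assms assms] by blast
    then have "\<bar>real_of_int n\<bar> < 1" using s by auto
    then have "n = 0" by linarith
    with n show "s = s'" by simp
  qed
  then have "inj_on (curve L j) (cuts L j \<inter> {r..<r + 1})" by (rule inj_on_subset) blast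
  moreover have "curve L j ` (cuts L j \<inter> {r..<r + 1}) \<subseteq> removed_points L"
    by (auto simp: cuts_def)
  ultimately show ?thesis using finite_removed_points by (meson finite_imageD finite_subset)
qed

section \<open>Intervals between consecutive cuts\<close>

lemma gap_shift:
  assumes "gap L j a b"
  shows "gap L j (a + of_int n) (b + of_int n)"
proof -
  have j: "j \<in> comps" using assms by (simp add: gap_def)
  have "r \<notin> cuts L j" if "r \<in> {a + of_int n<..<b + of_int n}" for r
  proof -
    have "r - of_int n \<in> {a<..<b}" using that by auto
    then have "r - of_int n \<notin> cuts L j" using assms by (auto simp: gap_def)
    then show ?thesis using cuts_shift[OF j, of "r - of_int n" n] by simp
  qed
  then show ?thesis using assms by (auto simp: gap_def cuts_shift)
qed

text \<open>Periodicity puts a cut at \<open>a + 1\<close>, so the finite set of cuts in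
  \<open>(a, a + 1]\<close> is nonempty and its minimum is the right end.\<close>

lemma gap_right_exists:
  assumes j: "j \<in> comps" and a: "a \<in> cuts L j"
  obtains b where "gap L j a b"
proof
  let ?A = "cuts L j \<inter> {a<..a + 1}"
  have "?A \<subseteq> insert (a + 1) (cuts L j \<inter> {a..<a + 1})" by auto
  then have fin: "finite ?A" using finite_cuts[OF j] by (meson finite.insertI finite_subset)
  have ne: "a + 1 \<in> ?A" using cuts_shift[OF j, of a 1] a by simp
  then have "Min ?A \<in> ?A" using fin by (intro Min_in) auto
  moreover have "r \<notin> cuts L j" if "r \<in> {a<..<Min ?A}" for r
  proof
    assume "r \<in> cuts L j"
    then have "r \<in> ?A" using that \<open>Min ?A \<in> ?A\<close> by auto
    then show False using Min_le[OF fin] that by fastforce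
  qed
  ultimately show "gap L j a (Min ?A)" using j a by (auto simp: gap_def)
qed

lemma gap_left_exists:
  assumes j: "j \<in> comps" and b: "b \<in> cuts L j"
  obtains a where "gap L j a b"
proof
  let ?A = "cuts L j \<inter> {b - 1..<b}"
  have fin: "finite ?A" using finite_cuts[OF j, of "b - 1"] by simp
  have ne: "b - 1 \<in> ?A" using cuts_shift[OF j, of b "-1"] b by simp
  then have "Max ?A \<in> ?A" using fin by (intro Max_in) auto
  moreover have "r \<notin> cuts L j" if "r \<in> {Max ?A<..<b}" for r
  proof
    assume "r \<in> cuts L j"
    then have "r \<in> ?A" using that \<open>Max ?A \<in> ?A\<close> by auto
    then show False using Max_ge[OF fin] that by fastforce
  qed
  ultimately show "gap L j (Max ?A) b" using j b by (auto simp: gap_def)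
qed

lemma gap_cover:
  assumes j: "j \<in> comps" and r: "r \<notin> cuts L j" and ne: "cuts L j \<noteq> {}"
  obtains a b where "gap L j a b" "r \<in> {a<..<b}"
proof -
  obtain p where p: "p \<in> cuts L j" using ne by blast
  let ?A = "cuts L j \<inter> {r - 1..<r}"
  have fin: "finite ?A" using finite_cuts[OF j, of "r - 1"] by simp
  \<comment> \<open>The integer with \<open>r - 1 \<le> p + ?n < r\<close>; it moves the cut
    \<open>p\<close> into the last period before \<open>r\<close>.\<close>
  let ?n = "\<lceil>r - p\<rceil> - 1"
  have "p + of_int ?n \<in> {r - 1..<r}" by simp linarith
  then have "p + of_int ?n \<in> ?A" using cuts_shift[OF j, of p ?n] p by blast
  then have a: "Max ?A \<in> ?A" using fin by (intro Max_in) auto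
  then obtain b where b: "gap L j (Max ?A) b" using gap_right_exists[OF j] by blast
  have "r < b"
  proof (rule ccontr)
    assume "\<not> r < b"
    moreover have "b \<noteq> r" using b r by (auto simp: gap_def)
    ultimately have "b \<in> ?A" using b a by (auto simp: gap_def)
    then show False using Max_ge[OF fin] b by (fastforce simp: gap_def)
  qed
  with a b show ?thesis by (intro that[of "Max ?A" b]) auto
qed

lemma gap_image_shift:
  assumes "j \<in> comps"
  shows "curve L j ` {a + of_int n<..<b + of_int n} = curve L j ` {a<..<b}"
proof -
  have "{a + of_int n<..<b + of_int n} = (\<lambda>x. x + of_int n) ` {a<..<b}"
  proof (intro equalityI subsetI)
    fix x assume "x \<in> {a + of_int n<..<b + of_int n}"
    then show "x \<in> (\<lambda>x. x + of_int n) ` {a<..<b}"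
      by (intro image_eqI[of _ _ "x - of_int n"]) auto
  qed auto
  then show ?thesis by (simp add: image_image curve_shift[OF assms])
qed

text \<open>A common point has parameters that differ by an integer. After that shift the two
  intervals overlap, and overlapping intervals between consecutive cuts coincide.\<close>

lemma gap_images_meet:
  assumes g: "gap L j a b" "gap L j' a' b'"
    and meet: "x \<in> curve L j ` {a<..<b}" "x \<in> curve L j' ` {a'<..<b'}"
  shows "j' = j" "\<exists>n::int. a' = a + of_int n \<and> b' = b + of_int n"
proof -
  have j: "j \<in> comps" "j' \<in> comps" using g by (auto simp: gap_def)
  obtain r r' where r: "r \<in> {a<..<b}" "r' \<in> {a'<..<b'}" "curve L j r = curve L j' r'"
    using meet by auto
  show jj: "j' = j" using curve_eqD(1)[OF j r(3)] .
  obtain n :: int where n: "r' = r + of_int n" using curve_eqD(2)[OF j r(3)] by blast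
  have "r' \<in> {a + of_int n<..<b + of_int n}" using r(1) n by simp
  then have "a + of_int n = a'" "b + of_int n = b'"
    using gap_unique[OF gap_shift[OF g(1), of n] g(2)[unfolded jj]] r(2) by blast+
  then show "\<exists>n::int. a' = a + of_int n \<and> b' = b + of_int n" by metis
qed

section \<open>Explicit list of the arcs\<close>

definition arc_family :: "(real^3) set set" where
  "arc_family = {curve L j ` {a<..<b} | j a b. gap L j a b} \<union>
     {range (curve L j) | j. j \<in> comps \<and> cuts L j = {}}"

text \<open>Every gap can be translated so that its left end lies in \<open>[0,1)\<close> and is the
  parameter of some \<open>cpt L i b\<close>. The left end determines the right end, so
  \<open>SOME\<close> returns it.\<close>

lemma finite_arc_family: "finite arc_family"
proof -
  define F where "F p = (case p of (j, a) \<Rightarrow> curve L j ` {a<..<(SOME b. gap L j a b)})" for p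
  have "curve L j ` {a<..<b} \<in> (\<lambda>(i, b). F (cpt L i b)) ` (crossings \<times> UNIV)"
    if g: "gap L j a b" for j a b
  proof -
    have j: "j \<in> comps" and a: "a \<in> cuts L j" using g by (auto simp: gap_def)
    have g': "gap L j (frac a) (b - of_int \<lfloor>a\<rfloor>)"
      using gap_shift[OF g, of "- \<lfloor>a\<rfloor>"] by (simp add: frac_def)
    have "gap L j (frac a) (SOME b. gap L j (frac a) b)" using g' by (rule someI)
    then have "(SOME b. gap L j (frac a) b) = b - of_int \<lfloor>a\<rfloor>"
      using g' unfolding gap_def disjoint_iff greaterThanLessThan_iff by (meson linorder_neqE)
    then have "F (j, frac a) = curve L j ` {a<..<b}"
      using gap_image_shift[OF j, of a "- \<lfloor>a\<rfloor>" b] by (simp add: F_def frac_def)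
    moreover obtain i c where "i \<in> crossings" "cpt L i c = (j, frac a)"
      using a cuts_iff[OF j] by blast
    ultimately show ?thesis by (intro image_eqI[of _ _ "(i, c)"]) auto
  qed
  then have "{curve L j ` {a<..<b} | j a b. gap L j a b} \<subseteq>
      (\<lambda>(i, b). F (cpt L i b)) ` (crossings \<times> UNIV)" by blast
  then have "finite {curve L j ` {a<..<b} | j a b. gap L j a b}"
    by (rule finite_subset) simp
  then show ?thesis by (simp add: arc_family_def)
qed

lemma pairwise_disjnt_arc_family: "pairwise disjnt arc_family"
proof (rule pairwiseI, rule ccontr)
  fix A B assume A: "A \<in> arc_family" and B: "B \<in> arc_family" and "A \<noteq> B" "\<not> disjnt A B"
  then obtain x where x: "x \<in> A" "x \<in> B" by (auto simp: disjnt_def)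
  have mixed: False
    if "gap L j a b" "j' \<in> comps" "cuts L j' = {}" "x \<in> curve L j ` {a<..<b}" "x \<in> range (curve L j')"
    for j a b j'
    using that curve_eqD(1)[of j j'] by (auto simp: gap_def)
  show False
  proof (cases "\<exists>j a b. gap L j a b \<and> A = curve L j ` {a<..<b}")
    case True
    then obtain j a b where a: "gap L j a b" "A = curve L j ` {a<..<b}" by blast
    then obtain j' a' b' where b: "gap L j' a' b'" "B = curve L j' ` {a'<..<b'}"
      using B x mixed unfolding arc_family_def by blast
    have j: "j \<in> comps" using a by (simp add: gap_def)
    show False
      using gap_images_meet[OF a(1) b(1), of x] x \<open>A \<noteq> B\<close> gap_image_shift[OF j] unfolding a(2) b(2)
      by blast
  next
    case False
    then obtain j where j: "j \<in> comps" "cuts L j = {}" "A = range (curve L j)"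
      using A unfolding arc_family_def by blast
    then obtain j' where j': "j' \<in> comps" "B = range (curve L j')"
      using B x mixed unfolding arc_family_def by blast
    then show False using j x curve_eqD(1)[of j j'] \<open>A \<noteq> B\<close> by auto
  qed
qed

text \<open>The image of an open gap is the compact image of the closed interval without its end
  points, which are removed points, so it is closed in the cut link. An uncut component is
  compact.\<close>

lemma arcs_eq: "arcs L = arc_family"
  unfolding arcs_def
proof (rule components_eq_closed_partition[OF finite_arc_family _ pairwise_disjnt_arc_family])
  let ?X = "(\<Union>j\<in>comps. range (curve L j)) - removed_points L"
  show Un: "\<Union>arc_family = ?X"
  proof (intro equalityI subsetI)
    fix x assume "x \<in> \<Union>arc_family"
    then obtain j r where "j \<in> comps" "x = curve L j r" "r \<notin> cuts L j"
      unfolding arc_family_def by (auto simp: gap_def)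
    then show "x \<in> ?X" unfolding cuts_def by blast
  next
    fix x assume "x \<in> ?X"
    then obtain j r where j: "j \<in> comps" "x = curve L j r" "r \<notin> cuts L j" by (auto simp: cuts_def)
    show "x \<in> \<Union>arc_family"
    proof (cases "cuts L j = {}")
      case True
      then show ?thesis using j unfolding arc_family_def by blast
    next
      case False
      then obtain a b where "gap L j a b" "r \<in> {a<..<b}" using gap_cover j by blast
      then show ?thesis using j(2) unfolding arc_family_def by blast
    qed
  qed
  fix C assume C: "C \<in> arc_family"
  then have CX: "C \<subseteq> ?X" using Un by blast
  show "connected C \<and> C \<noteq> {} \<and> closedin (top_of_set ?X) C"
  proof (cases "\<exists>j a b. gap L j a b \<and> C = curve L j ` {a<..<b}")
    case True
    then obtain j a b where g: "gap L j a b" and eq: "C = curve L j ` {a<..<b}" by blast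
    have j: "j \<in> comps" using g by (simp add: gap_def)
    have "connected C"
      unfolding eq by (intro connected_continuous_image continuous_on_curve[OF j]) auto
    moreover have "C \<noteq> {}" using g by (simp add: eq gap_def)
    moreover have "C = ?X \<inter> curve L j ` {a..b}"
    proof
      show "C \<subseteq> ?X \<inter> curve L j ` {a..b}" using CX eq by auto
      have "{a..b} = insert a (insert b {a<..<b})" using g by (auto simp: gap_def)
      moreover have "curve L j a \<in> removed_points L" "curve L j b \<in> removed_points L"
        using g by (auto simp: gap_def cuts_def)
      ultimately show "?X \<inter> curve L j ` {a..b} \<subseteq> C" unfolding eq by auto
    qed
    moreover have "closed (curve L j ` {a..b})"
      by (intro compact_imp_closed compact_continuous_image continuous_on_curve[OF j]) simp
    ultimately show ?thesis by (metis closedin_closed_Int)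
  next
    case False
    then obtain j where j: "j \<in> comps" "C = range (curve L j)"
      using C unfolding arc_family_def by blast
    have "range (curve L j) = curve L j ` {0..1}"
    proof -
      have "curve L j r \<in> curve L j ` {0..1}" for r
        using curve_frac[OF j(1), of r] frac_lt_1[of r]
        by (intro image_eqI[of _ _ "frac r"]) auto
      then show ?thesis by auto
    qed
    then have "closed C" unfolding j(2)
      by (metis compact_imp_closed compact_continuous_image continuous_on_curve[OF j(1)] compact_Icc)
    moreover have "connected C"
      unfolding j(2) by (intro connected_continuous_image continuous_on_curve[OF j(1)]) auto
    moreover have "C \<noteq> {}" using j by simp
    ultimately show ?thesis using CX by (metis closed_subset)
  qed
qed

section \<open>Incoming and outgoing arcs of a removed point\<close>

lemma finite_arcs: "finite (arcs L)"
  by (simp add: arcs_eq finite_arc_family)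

lemma arcs_disjoint:
  "a \<in> arcs L \<Longrightarrow> a' \<in> arcs L \<Longrightarrow> x \<in> a \<Longrightarrow> x \<in> a' \<Longrightarrow> a = a'"
  using pairwiseD[OF pairwise_disjnt_arc_family, of a a'] by (auto simp: arcs_eq disjnt_iff)

lemma gap_in_arcs: "gap L j a b \<Longrightarrow> curve L j ` {a<..<b} \<in> arcs L"
  unfolding arcs_eq arc_family_def by blast

text \<open>Any arc containing the strand just before the point meets the image of the gap, and
  distinct arcs are disjoint; hence the description by \<open>THE\<close> has a unique
  solution.\<close>

lemma in_arc_eq:
  assumes c: "cpt L i b = (j, s)" and g: "gap L j a s"
  shows "in_arc L i b = curve L j ` {a<..<s}"
proof -
  let ?P = "\<lambda>C. \<forall>\<^sub>F r in at_left s. curve L j r \<in> C"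
  have "a < s" using g by (simp add: gap_def)
  then have ev: "?P (curve L j ` {a<..<s})"
    by (rule eventually_mono[OF eventually_at_left_real]) auto
  have uniq: "C = curve L j ` {a<..<s}" if C: "C \<in> arcs L" "?P C" for C
  proof -
    have "\<exists>r. curve L j r \<in> C \<and> curve L j r \<in> curve L j ` {a<..<s}"
      using eventually_happens'[OF trivial_limit_at_left_real eventually_conj[OF C(2) ev]] .
    then show ?thesis using arcs_disjoint[OF C(1) gap_in_arcs[OF g]] by blast
  qed
  show ?thesis
    unfolding in_arc_def c fst_conv snd_conv
    by (rule the_equality, rule conjI[OF gap_in_arcs[OF g] ev], elim conjE, rule uniq)
qed

lemma out_arc_eq:
  assumes c: "cpt L i b = (j, s)" and g: "gap L j s t"
  shows "out_arc L i b = curve L j ` {s<..<t}"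
proof -
  let ?P = "\<lambda>C. \<forall>\<^sub>F r in at_right s. curve L j r \<in> C"
  have "s < t" using g by (simp add: gap_def)
  then have ev: "?P (curve L j ` {s<..<t})"
    by (rule eventually_mono[OF eventually_at_right_real]) auto
  have uniq: "C = curve L j ` {s<..<t}" if C: "C \<in> arcs L" "?P C" for C
  proof -
    have "\<exists>r. curve L j r \<in> C \<and> curve L j r \<in> curve L j ` {s<..<t}"
      using eventually_happens'[OF trivial_limit_at_right_real eventually_conj[OF C(2) ev]] .
    then show ?thesis using arcs_disjoint[OF C(1) gap_in_arcs[OF g]] by blast
  qed
  show ?thesis
    unfolding out_arc_def c fst_conv snd_conv
    by (rule the_equality, rule conjI[OF gap_in_arcs[OF g] ev], elim conjE, rule uniq)
qed

lemma cpt_cuts: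
  assumes "i \<in> crossings"
  obtains j s where "cpt L i b = (j, s)" "j \<in> comps" "s \<in> cuts L j" "0 \<le> s" "s < 1"
proof -
  obtain j s where c: "cpt L i b = (j, s)" by fastforce
  with cpt_in_params[OF assms, of b] have *: "j \<in> comps" "0 \<le> s" "s < 1"
    by (auto simp: params_def)
  have "frac s = s" using *(2,3) by (simp add: frac_eq)
  then have "s \<in> cuts L j" unfolding cuts_iff[OF *(1)] using assms c by auto
  then show ?thesis using that[OF c] * by simp
qed

lemma in_arc_in_arcs:
  assumes "i \<in> crossings"
  shows "in_arc L i b \<in> arcs L"
proof -
  obtain j s where s: "cpt L i b = (j, s)" "j \<in> comps" "s \<in> cuts L j"
    by (rule cpt_cuts[OF assms])
  obtain a where "gap L j a s" using gap_left_exists[OF s(2,3)] .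
  then show ?thesis using in_arc_eq[OF s(1)] gap_in_arcs by simp
qed

lemma out_arc_in_arcs:
  assumes "i \<in> crossings"
  shows "out_arc L i b \<in> arcs L"
proof -
  obtain j s where s: "cpt L i b = (j, s)" "j \<in> comps" "s \<in> cuts L j"
    by (rule cpt_cuts[OF assms])
  obtain t where "gap L j s t" using gap_right_exists[OF s(2,3)] .
  then show ?thesis using out_arc_eq[OF s(1)] gap_in_arcs by simp
qed

text \<open>Equal arcs come from gaps that differ by an integer translation. Both right ends lie in
  \<open>[0,1)\<close>, so the translation is zero and the removed points agree.\<close>

lemma in_arc_inj:
  assumes i: "i \<in> crossings" "i' \<in> crossings" and eq: "in_arc L i b = in_arc L i' b'"
  shows "i = i' \<and> b = b'"
proof -
  obtain j s where s: "cpt L i b = (j, s)" "j \<in> comps" "s \<in> cuts L j" "0 \<le> s" "s < 1"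
    by (rule cpt_cuts[OF i(1)])
  obtain j' s' where s': "cpt L i' b' = (j', s')" "j' \<in> comps" "s' \<in> cuts L j'" "0 \<le> s'" "s' < 1"
    by (rule cpt_cuts[OF i(2)])
  obtain a where a: "gap L j a s" using gap_left_exists[OF s(2,3)] .
  obtain a' where a': "gap L j' a' s'" using gap_left_exists[OF s'(2,3)] .
  have im: "curve L j ` {a<..<s} = curve L j' ` {a'<..<s'}"
    using eq in_arc_eq[OF s(1) a] in_arc_eq[OF s'(1) a'] by simp
  have "a < s" using a by (simp add: gap_def)
  then obtain r where "r \<in> {a<..<s}" using dense[of a s] by auto
  then have x: "curve L j r \<in> curve L j ` {a<..<s}" by blast
  obtain n :: int where n: "j' = j" "s' = s + of_int n"
    using gap_images_meet[OF a a' x x[unfolded im]] by blast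
  then have "\<bar>real_of_int n\<bar> < 1" using s s' by auto
  then have "n = 0" by linarith
  then show ?thesis using cpt_inj[OF i, of b b'] s(1) s'(1) n by simp
qed

lemma out_arc_inj:
  assumes i: "i \<in> crossings" "i' \<in> crossings" and eq: "out_arc L i b = out_arc L i' b'"
  shows "i = i' \<and> b = b'"
proof -
  obtain j s where s: "cpt L i b = (j, s)" "j \<in> comps" "s \<in> cuts L j" "0 \<le> s" "s < 1"
    by (rule cpt_cuts[OF i(1)])
  obtain j' s' where s': "cpt L i' b' = (j', s')" "j' \<in> comps" "s' \<in> cuts L j'" "0 \<le> s'" "s' < 1"
    by (rule cpt_cuts[OF i(2)])
  obtain t where t: "gap L j s t" using gap_right_exists[OF s(2,3)] .
  obtain t' where t': "gap L j' s' t'" using gap_right_exists[OF s'(2,3)] .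
  have im: "curve L j ` {s<..<t} = curve L j' ` {s'<..<t'}"
    using eq out_arc_eq[OF s(1) t] out_arc_eq[OF s'(1) t'] by simp
  have "s < t" using t by (simp add: gap_def)
  then obtain r where "r \<in> {s<..<t}" using dense[of s t] by auto
  then have x: "curve L j r \<in> curve L j ` {s<..<t}" by blast
  obtain n :: int where n: "j' = j" "s' = s + of_int n"
    using gap_images_meet[OF t t' x x[unfolded im]] by blast
  then have "\<bar>real_of_int n\<bar> < 1" using s s' by auto
  then have "n = 0" by linarith
  then show ?thesis using cpt_inj[OF i, of b b'] s(1) s'(1) n by simp
qed

text \<open>Following the gap to its right end \<open>t\<close> reaches the next cut;
  \<open>t\<close> may exceed 1 and is therefore reduced to \<open>frac t\<close>. Hence an arc that
  \<open>next_arc\<close> fixes by its default branch is never an outgoing arc.\<close>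

lemma out_arc_is_in_arc:
  assumes i: "i \<in> crossings"
  shows "\<exists>i'\<in>crossings. \<exists>b'. out_arc L i b = in_arc L i' b'"
proof -
  obtain j s where s: "cpt L i b = (j, s)" "j \<in> comps" "s \<in> cuts L j"
    by (rule cpt_cuts[OF i])
  obtain t where t: "gap L j s t" using gap_right_exists[OF s(2,3)] .
  then have "t \<in> cuts L j" by (simp add: gap_def)
  then obtain i' b' where i': "i' \<in> crossings" "cpt L i' b' = (j, frac t)"
    using cuts_iff[OF s(2)] by blast
  have "gap L j (s - of_int \<lfloor>t\<rfloor>) (frac t)"
    using gap_shift[OF t, of "- \<lfloor>t\<rfloor>"] by (simp add: frac_def)
  then have "in_arc L i' b' = curve L j ` {s - of_int \<lfloor>t\<rfloor><..<frac t}"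
    by (rule in_arc_eq[OF i'(2)])
  also have "\<dots> = curve L j ` {s<..<t}"
    using gap_image_shift[OF s(2), of s "- \<lfloor>t\<rfloor>" t] by (simp add: frac_def)
  finally show ?thesis using i' out_arc_eq[OF s(1) t] by metis
qed

end

subsection \<open>Crossing operators on reconnected Wilson loops\<close>

text \<open>\<open>F + D F / w\<close> and \<open>F - D F / w\<close> are eigenvectors with
  eigenvalues \<open>w\<close> and \<open>- w\<close>, so the pointwise series splits into two
  exponential series.\<close>

lemma exp_op_square:
  assumes w: "w \<noteq> 0"
    and lin: "\<And>a b. D (\<lambda>h. a * F h + b * D F h) = (\<lambda>h. a * D F h + b * (w\<^sup>2 * F h))"
  shows "exp_op \<beta> D F = (\<lambda>h. cosh (w * \<beta>) * F h + sinh (w * \<beta>) / w * D F h)"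
proof
  fix h
  have pow: "(D ^^ n) F =
      (\<lambda>h. (w ^ n + (- w) ^ n) / 2 * F h + (w ^ n - (- w) ^ n) / (2 * w) * D F h)" for n
  proof (induction n)
    case (Suc n)
    have A: "(w ^ n - (- w) ^ n) / (2 * w) * w\<^sup>2 = (w ^ Suc n + (- w) ^ Suc n) / 2"
      and B: "(w ^ n + (- w) ^ n) / 2 = (w ^ Suc n - (- w) ^ Suc n) / (2 * w)"
      using w by (simp_all add: field_simps power2_eq_square)
    have "(D ^^ Suc n) F = (\<lambda>h. (w ^ n + (- w) ^ n) / 2 * D F h +
        (w ^ n - (- w) ^ n) / (2 * w) * (w\<^sup>2 * F h))"
      unfolding funpow.simps o_apply Suc.IH by (rule lin)
    then show ?case unfolding mult.assoc[symmetric] A B by (simp only: add.commute)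
  qed simp
  have e: "(\<lambda>n. (c * \<beta>) ^ n / fact n) sums exp (c * \<beta>)" for c
    using exp_converges[of "c * \<beta>"] by (simp add: scaleR_conv_of_real divide_inverse mult.commute)
  have "(\<lambda>n. (F h + D F h / w) / 2 * ((w * \<beta>) ^ n / fact n) +
      (F h - D F h / w) / 2 * ((- w * \<beta>) ^ n / fact n)) sums
      ((F h + D F h / w) / 2 * exp (w * \<beta>) + (F h - D F h / w) / 2 * exp (- w * \<beta>))"
    by (intro sums_add sums_mult e)
  moreover have "(F h + D F h / w) / 2 * ((w * \<beta>) ^ n / fact n) +
      (F h - D F h / w) / 2 * ((- w * \<beta>) ^ n / fact n) = \<beta> ^ n / fact n * (D ^^ n) F h" for n
    unfolding pow power_mult_distrib using w by (simp add: field_simps)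
  moreover have "(F h + D F h / w) / 2 * exp (w * \<beta>) + (F h - D F h / w) / 2 * exp (- w * \<beta>) =
      cosh (w * \<beta>) * F h + sinh (w * \<beta>) / w * D F h"
    using w by (simp add: cosh_field_def sinh_field_def field_simps)
  ultimately show "exp_op \<beta> D F h = cosh (w * \<beta>) * F h + sinh (w * \<beta>) / w * D F h"
    unfolding exp_op_def by (simp add: sums_iff)
qed

lemma crossing_op_linear:
  assumes F: "F \<in> poly_functions (arcs L)" and G: "G \<in> poly_functions (arcs L)"
  shows "crossing_op L e i (\<lambda>h. a * F h + b * G h) =
    (\<lambda>h. a * crossing_op L e i F h + b * crossing_op L e i G h)"
proof -
  note P = insertion_poly_functions
  have lin: "insertion L i c Y (\<lambda>h. a * F h + b * G h) =
      (\<lambda>h. a * insertion L i c Y F h + b * insertion L i c Y G h)"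
    if "F \<in> poly_functions (arcs L)" "G \<in> poly_functions (arcs L)" for c Y F G
    using that by (simp add: P(2)[OF poly_functions_scale poly_functions_scale] P(3)[OF _ poly_functions.const])
  have "insertion L i True (e \<alpha>) (insertion L i False (e \<gamma>) (\<lambda>h. a * F h + b * G h)) =
      (\<lambda>h. a * insertion L i True (e \<alpha>) (insertion L i False (e \<gamma>) F) h +
           b * insertion L i True (e \<alpha>) (insertion L i False (e \<gamma>) G) h)" for \<alpha> \<gamma>
    by (simp add: lin F G P(1)[OF _ poly_functions.const])
  then show ?thesis
    by (simp add: crossing_op_def fun_eq_iff distrib_left sum.distrib sum_distrib_left mult_ac)
qed

text \<open>The symmetric difference with \<open>{i}\<close>, so that smoothing a crossing and
  undoing the smoothing obey one formula.\<close>

definition flip :: "nat \<Rightarrow> nat set \<Rightarrow> nat set" where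
  "flip i T = (if i \<in> T then T - {i} else insert i T)"

lemma flip_flip [simp]: "flip i (flip i T) = T"
  by (auto simp: flip_def)

lemma flip_commute: "flip i (flip j T) = flip j (flip i T)"
  by (auto simp: flip_def)

lemma mem_flip [simp]: "j \<in> flip i T \<longleftrightarrow> (if j = i then j \<notin> T else j \<in> T)"
  by (auto simp: flip_def)

section \<open>The successor permutation of the arcs\<close>

context generic_link
begin

lemma next_arc_in_arc:
  assumes "i \<in> crossings"
  shows "next_arc L S (in_arc L i b) = out_arc L i (if i \<in> S then \<not> b else b)"
proof -
  have "(THE c. \<exists>i'\<in>crossings. \<exists>b'. in_arc L i b = in_arc L i' b' \<and>
      c = out_arc L i' (if i' \<in> S then \<not> b' else b')) = out_arc L i (if i \<in> S then \<not> b else b)"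
  proof (rule the_equality)
    show "\<exists>i'\<in>crossings. \<exists>b'. in_arc L i b = in_arc L i' b' \<and>
      out_arc L i (if i \<in> S then \<not> b else b) = out_arc L i' (if i' \<in> S then \<not> b' else b')"
      using assms by blast
    fix c assume "\<exists>i'\<in>crossings. \<exists>b'. in_arc L i b = in_arc L i' b' \<and>
      c = out_arc L i' (if i' \<in> S then \<not> b' else b')"
    then obtain i' b' where "i' \<in> crossings" "in_arc L i b = in_arc L i' b'"
      "c = out_arc L i' (if i' \<in> S then \<not> b' else b')" by blast
    then show "c = out_arc L i (if i \<in> S then \<not> b else b)"
      using in_arc_inj[OF assms, of i' b b'] by simp
  qed
  moreover have "\<exists>i'\<in>crossings. \<exists>b'. in_arc L i b = in_arc L i' b'" using assms by blast
  ultimately show ?thesis unfolding next_arc_def by simp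
qed

lemma next_arc_other:
  assumes "\<And>i b. i \<in> crossings \<Longrightarrow> a \<noteq> in_arc L i b"
  shows "next_arc L S a = a"
  unfolding next_arc_def using assms by auto

text \<open>Incoming arcs have distinct successors since exchanging labels is injective, all other
  arcs are fixed, and the two kinds cannot collide because every outgoing arc is itself incoming
  somewhere. Finiteness then gives surjectivity.\<close>

lemma next_arc_permutes: "next_arc L S permutes arcs L"
proof (rule bij_imp_permutes)
  let ?f = "next_arc L S"
  have maps: "?f ` arcs L \<subseteq> arcs L"
  proof
    fix x assume "x \<in> ?f ` arcs L"
    then obtain a where a: "a \<in> arcs L" "x = ?f a" by blast
    show "x \<in> arcs L"
    proof (cases "\<exists>i\<in>crossings. \<exists>b. a = in_arc L i b")
      case True
      then obtain i b where "i \<in> crossings" "a = in_arc L i b" by blast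
      then show ?thesis using out_arc_in_arcs[of i] by (simp add: a(2) next_arc_in_arc)
    next
      case False
      then have "?f a = a" by (intro next_arc_other) blast
      then show ?thesis using a by simp
    qed
  qed
  have out: False
    if i: "i \<in> crossings" and a': "\<not> (\<exists>i\<in>crossings. \<exists>b. a' = in_arc L i b)"
      and eq: "next_arc L S (in_arc L i b) = next_arc L S a'" for i b a'
  proof -
    have "next_arc L S a' = a'" using a' by (intro next_arc_other) blast
    then have "a' = out_arc L i (if i \<in> S then \<not> b else b)"
      using eq next_arc_in_arc[OF i, of S b] by simp
    moreover obtain i' b' where "i' \<in> crossings"
      "out_arc L i (if i \<in> S then \<not> b else b) = in_arc L i' b'"
      using out_arc_is_in_arc[OF i] by blast
    ultimately have "a' = in_arc L i' b'" by simp
    then show False using a' \<open>i' \<in> crossings\<close> by blast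
  qed
  have inj: "inj_on ?f (arcs L)"
  proof (rule inj_onI)
    fix a a' assume eq: "?f a = ?f a'"
    show "a = a'"
    proof (cases "\<exists>i\<in>crossings. \<exists>b. a = in_arc L i b")
      case True
      then obtain i b where a: "i \<in> crossings" "a = in_arc L i b" by blast
      show ?thesis
      proof (cases "\<exists>i\<in>crossings. \<exists>b. a' = in_arc L i b")
        case True
        then obtain i' b' where a': "i' \<in> crossings" "a' = in_arc L i' b'" by blast
        have "out_arc L i (if i \<in> S then \<not> b else b) = out_arc L i' (if i' \<in> S then \<not> b' else b')"
          using eq unfolding a(2) a'(2) next_arc_in_arc[OF a(1)] next_arc_in_arc[OF a'(1)] .
        from out_arc_inj[OF a(1) a'(1) this] have "i = i' \<and> b = b'"
          by (cases "i \<in> S") auto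
        then show ?thesis using a a' by simp
      next
        case False
        then have False using out[OF a(1) False, of b] eq[unfolded a(2)] by blast
        then show ?thesis ..
      qed
    next
      case False
      show ?thesis
      proof (cases "\<exists>i\<in>crossings. \<exists>b. a' = in_arc L i b")
        case True
        then obtain i' b' where "i' \<in> crossings" "a' = in_arc L i' b'" by blast
        then have False using out[of i' a b'] False eq[symmetric] by blast
        then show ?thesis ..
      next
        case False': False
        have "a = ?f a" by (rule next_arc_other[symmetric]) (use False in blast)
        also note eq
        also have "?f a' = a'" by (rule next_arc_other) (use False' in blast)
        finally show ?thesis .
      qed
    qed
  qed
  show "bij_betw ?f (arcs L) (arcs L)"
    using inj endo_inj_surj[OF finite_arcs maps inj] by (simp add: bij_betw_def)
  show "?f x = x" if "x \<notin> arcs L" for x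
  proof (rule next_arc_other)
    show "x \<noteq> in_arc L i b" if "i \<in> crossings" for i b
      using in_arc_in_arcs[OF that, of b] \<open>x \<notin> arcs L\<close> by blast
  qed
qed

lemma next_arc_flip:
  assumes i: "i \<in> crossings"
  shows "next_arc L (flip i T) (in_arc L i b) = next_arc L T (in_arc L i (\<not> b))"
    and "a \<noteq> in_arc L i True \<Longrightarrow> a \<noteq> in_arc L i False \<Longrightarrow> next_arc L (flip i T) a = next_arc L T a"
proof -
  show "next_arc L (flip i T) (in_arc L i b) = next_arc L T (in_arc L i (\<not> b))"
    by (simp add: next_arc_in_arc[OF i])
  assume a: "a \<noteq> in_arc L i True" "a \<noteq> in_arc L i False"
  show "next_arc L (flip i T) a = next_arc L T a"
  proof (cases "\<exists>i'\<in>crossings. \<exists>b. a = in_arc L i' b")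
    case True
    then obtain i' b where i': "i' \<in> crossings" "a = in_arc L i' b" by blast
    then have "i' \<noteq> i" using a by (cases b) auto
    then show ?thesis by (simp add: i'(2) next_arc_in_arc[OF i'(1)])
  next
    case False
    then have "next_arc L X a = a" for X by (intro next_arc_other) blast
    then show ?thesis by simp
  qed
qed

lemma wilson_function_eq_dressed:
  "wilson_function L T = dressed (arcs L) (next_arc L T) (\<lambda>_. mat 1)"
  unfolding dressed_one by (rule wilson_function_eq_contraction[OF finite_arcs next_arc_permutes])

lemma wilson_function_in_poly_functions: "wilson_function L T \<in> poly_functions (arcs L)"
  unfolding wilson_function_eq_dressed by (rule dressed_in_poly_functions[OF finite_arcs])

text \<open>The arc before out(p) carries the same label if \<open>i \<notin> T\<close> and the
  opposite one otherwise. The half coming from in(p) goes in front of the matrix already at its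
  junction, the half slid from out(p) goes behind; this fixes the order of two generators at one
  junction.\<close>

lemma insertion_dressed_at:
  assumes i: "i \<in> crossings"
  shows "insertion L i b Y (dressed (arcs L) (next_arc L T) M) =
    (\<lambda>h. 1/2 * dressed (arcs L) (next_arc L T) (M(in_arc L i b := Y ** M (in_arc L i b))) h +
         1/2 * dressed (arcs L) (next_arc L T)
           (let q = in_arc L i (if i \<in> T then \<not> b else b) in M(q := M q ** Y)) h)"
  unfolding Let_def
  by (rule insertion_dressed[OF finite_arcs permutes_imp_bij[OF next_arc_permutes]])
    (auto simp: in_arc_in_arcs[OF i] next_arc_in_arc[OF i])

end

section \<open>Action of one crossing operator on the Wilson functions\<close>

locale fierz_link = generic_link L for L +
  fixes e :: "'b::finite \<Rightarrow> complex^2^2"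
  assumes fierz_e: "fierz (1/2) (\<lambda>\<alpha> \<beta>. matrix_inv (gram e) $ \<alpha> $ \<beta>) e"
begin

abbreviation W :: "nat set \<Rightarrow> 2 arc_function" where "W \<equiv> wilson_function L"

abbreviation casimir :: "('b \<Rightarrow> 'b \<Rightarrow> complex) \<Rightarrow> complex" where
  "casimir f \<equiv> \<Sum>\<alpha>\<in>UNIV. \<Sum>\<beta>\<in>UNIV. matrix_inv (gram e) $ \<alpha> $ \<beta> * f \<alpha> \<beta>"

text \<open>The prefactor \<open>4 * step\<close> of \<open>crossing_op\<close> is
  \<open>2 * eps i\<close>. As \<open>step\<close> equals 1/2 at zero, \<open>eps i\<close> is
  always 1 or -1.\<close>

definition eps :: "nat \<Rightarrow> complex" where
  "eps i = 2 * complex_of_real (step (height_diff L i))"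

lemma eps_square: "eps i * eps i = 1"
  by (simp add: eps_def step_def)

definition diag_coeff :: "nat \<Rightarrow> nat set \<Rightarrow> complex" where
  "diag_coeff i T = (if i \<in> T then eps i else - eps i)"

definition flip_coeff :: "nat \<Rightarrow> nat set \<Rightarrow> complex" where
  "flip_coeff i T = (if i \<in> T then eps i else 2 * eps i)"

lemma coeff_flip:
  "diag_coeff i (flip i T) = - diag_coeff i T"
  "i \<noteq> j \<Longrightarrow> diag_coeff i (flip j T) = diag_coeff i T"
  "i \<noteq> j \<Longrightarrow> flip_coeff i (flip j T) = flip_coeff i T"
  by (auto simp: diag_coeff_def flip_coeff_def)

lemma coeff_square:
  "diag_coeff i T * diag_coeff i T + flip_coeff i T * flip_coeff i (flip i T) = 3"
  using eps_square[of i] by (simp add: diag_coeff_def flip_coeff_def)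

lemma casimir_linear:
  "casimir (\<lambda>\<alpha> \<beta>. c * (f \<alpha> \<beta> + g \<alpha> \<beta> + k \<alpha> \<beta> + l \<alpha> \<beta>)) =
    c * (casimir f + casimir g + casimir k + casimir l)"
  by (simp add: sum.distrib distrib_left sum_distrib_left mult.left_commute)

text \<open>The generators sit at the two different junctions of the crossing, so the flip part
  exchanges the successors there, which toggles the smoothing at \<open>i\<close>.\<close>

lemma casimir_two:
  assumes i: "i \<in> crossings" and b: "b \<noteq> c"
  shows "casimir (\<lambda>\<alpha> \<beta>. dressed (arcs L) (next_arc L T)
      ((\<lambda>_. mat 1)(in_arc L i b := e \<alpha>, in_arc L i c := e \<beta>)) h) = W (flip i T) h - 1/2 * W T h"
proof -
  let ?a = "in_arc L i b" and ?c = "in_arc L i c"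
  have ne: "?a \<noteq> ?c" using in_arc_inj[OF i i] b by blast
  have "dressed (arcs L) (next_arc L T) ((\<lambda>_. mat 1)(?a := e \<alpha>, ?c := e \<beta>)) h =
      contraction (arcs L) (next_arc L T) (h(?a := h ?a ** e \<alpha>, ?c := h ?c ** e \<beta>))" for \<alpha> \<beta>
    unfolding dressed_def using ne by (intro contraction_cong) auto
  moreover have "casimir (\<lambda>\<alpha> \<beta>. contraction (arcs L) (next_arc L T)
        (h(?a := h ?a ** e \<alpha>, ?c := h ?c ** e \<beta>))) =
      contraction (arcs L) (next_arc L (flip i T)) h - 1/2 * contraction (arcs L) (next_arc L T) h"
  proof (rule contraction_fierz_swap[OF finite_arcs in_arc_in_arcs[OF i] in_arc_in_arcs[OF i] ne fierz_e])
    show "next_arc L (flip i T) ?a = next_arc L T ?c" "next_arc L (flip i T) ?c = next_arc L T ?a"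
      using b by (cases b; cases c; simp add: next_arc_flip(1)[OF i])+
    show "next_arc L (flip i T) x = next_arc L T x" if "x \<noteq> ?a" "x \<noteq> ?c" for x
      using that b by (cases b; cases c) (simp_all add: next_arc_flip(2)[OF i])
  qed
  ultimately show ?thesis by (simp add: wilson_function_eq_dressed dressed_one)
qed

text \<open>Both generators sit at one junction, and either order gives the scalar
  \<open>2 - 1/2\<close>.\<close>

lemma casimir_one:
  assumes i: "i \<in> crossings"
  shows "casimir (\<lambda>\<alpha> \<beta>. dressed (arcs L) (next_arc L T)
      ((\<lambda>_. mat 1)(in_arc L i b := e \<alpha> ** e \<beta>)) h) = 3/2 * W T h"
    and "casimir (\<lambda>\<alpha> \<beta>. dressed (arcs L) (next_arc L T)
      ((\<lambda>_. mat 1)(in_arc L i b := e \<beta> ** e \<alpha>)) h) = 3/2 * W T h"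
proof -
  let ?a = "in_arc L i b"
  have d: "dressed (arcs L) (next_arc L T) ((\<lambda>_. mat 1)(?a := E)) h =
      contraction (arcs L) (next_arc L T) (h(?a := h ?a ** E))" for E
    unfolding dressed_def by (intro contraction_cong) auto
  note same = contraction_fierz_same[OF finite_arcs in_arc_in_arcs[OF i]]
  have [simp]: "of_nat CARD(2) - 1/2 = (3/2 :: complex)" by simp
  show "casimir (\<lambda>\<alpha> \<beta>. dressed (arcs L) (next_arc L T) ((\<lambda>_. mat 1)(?a := e \<alpha> ** e \<beta>)) h) = 3/2 * W T h"
    unfolding d same[OF fierz_product(1)[OF fierz_e]]
    by (simp add: wilson_function_eq_dressed dressed_one)
  show "casimir (\<lambda>\<alpha> \<beta>. dressed (arcs L) (next_arc L T) ((\<lambda>_. mat 1)(?a := e \<beta> ** e \<alpha>)) h) = 3/2 * W T h"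
    unfolding d same[OF fierz_product(2)[OF fierz_e]]
    by (simp add: wilson_function_eq_dressed dressed_one)
qed

lemma crossing_op_wilson:
  assumes i: "i \<in> crossings"
  shows "crossing_op L e i (W T) =
    (\<lambda>h. diag_coeff i T * W T h + flip_coeff i T * W (flip i T) h)"
proof
  fix h
  let ?D = "dressed (arcs L) (next_arc L T)" and ?p = "in_arc L i True" and ?q = "in_arc L i False"
  let ?I = "\<lambda>\<alpha> \<beta>. insertion L i True (e \<alpha>) (insertion L i False (e \<beta>) (W T)) h"
  have ne: "?p \<noteq> ?q" using in_arc_inj[OF i i] by blast
  have op: "crossing_op L e i (W T) h = 2 * eps i * casimir ?I"
    by (simp add: crossing_op_def eps_def)
  show "crossing_op L e i (W T) h = diag_coeff i T * W T h + flip_coeff i T * W (flip i T) h"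
  proof (cases "i \<in> T")
    case False
    \<comment> \<open>Without smoothing, the arc preceding out(p) is in(p), so the two halves of
      each derivative coincide and add up to one insertion.\<close>
    have "?I \<alpha> \<beta> = ?D ((\<lambda>_. mat 1)(?q := e \<beta>, ?p := e \<alpha>)) h" for \<alpha> \<beta>
      using False ne
      by (simp add: wilson_function_eq_dressed insertion_dressed_at[OF i])
    then have "?I \<alpha> \<beta> = ?D ((\<lambda>_. mat 1)(?p := e \<alpha>, ?q := e \<beta>)) h" for \<alpha> \<beta>
      using ne by (simp add: fun_upd_twist)
    then have c: "casimir ?I = W (flip i T) h - 1/2 * W T h"
      by (simp add: casimir_two[OF i])
    show ?thesis unfolding op c using False by (simp add: diag_coeff_def flip_coeff_def algebra_simps)
  next
    case True
    have tf: "True \<noteq> False" "False \<noteq> True" by simp_all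
    have poly: "?D M \<in> poly_functions (arcs L)" for M
      by (rule dressed_in_poly_functions[OF finite_arcs])
    have lin: "insertion L i True Y (\<lambda>h. 1/2 * ?D M h + 1/2 * ?D M' h) =
        (\<lambda>h. 1/2 * insertion L i True Y (?D M) h + 1/2 * insertion L i True Y (?D M') h)" for Y M M'
      by (simp only: insertion_poly_functions(2)[OF poly_functions_scale[OF poly] poly_functions_scale[OF poly]]
         insertion_poly_functions(3)[OF poly poly])
    have F: "insertion L i False Y (W T) =
        (\<lambda>h. 1/2 * ?D ((\<lambda>_. mat 1)(?q := Y)) h + 1/2 * ?D ((\<lambda>_. mat 1)(?p := Y)) h)" for Y
      using insertion_dressed_at[OF i, of False Y T "\<lambda>_. mat 1"] True
      by (simp add: wilson_function_eq_dressed)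
    have Tq: "insertion L i True X (?D ((\<lambda>_. mat 1)(?q := Y))) =
        (\<lambda>h. 1/2 * ?D ((\<lambda>_. mat 1)(?p := X, ?q := Y)) h + 1/2 * ?D ((\<lambda>_. mat 1)(?q := Y ** X)) h)"
      for X Y
      using insertion_dressed_at[OF i, of True X T "(\<lambda>_. mat 1)(?q := Y)"] True ne
      by (simp add: fun_upd_twist[OF ne])
    have Tp: "insertion L i True X (?D ((\<lambda>_. mat 1)(?p := Y))) =
        (\<lambda>h. 1/2 * ?D ((\<lambda>_. mat 1)(?p := X ** Y)) h + 1/2 * ?D ((\<lambda>_. mat 1)(?q := X, ?p := Y)) h)"
      for X Y
      using insertion_dressed_at[OF i, of True X T "(\<lambda>_. mat 1)(?p := Y)"] True ne
      by (simp add: fun_upd_twist[OF ne])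
    \<comment> \<open>Each derivative contributes one half at \<open>?p\<close> and one half at
      \<open>?q\<close>: two of the four products separate the generators, the other two place both
      at the same junction.\<close>
    have "?I \<alpha> \<beta> = 1/4 * (?D ((\<lambda>_. mat 1)(?p := e \<alpha>, ?q := e \<beta>)) h +
        ?D ((\<lambda>_. mat 1)(?q := e \<beta> ** e \<alpha>)) h + ?D ((\<lambda>_. mat 1)(?p := e \<alpha> ** e \<beta>)) h +
        ?D ((\<lambda>_. mat 1)(?q := e \<alpha>, ?p := e \<beta>)) h)" for \<alpha> \<beta>
      unfolding F lin Tq Tp by algebra
    then have "casimir ?I = casimir (\<lambda>\<alpha> \<beta>. 1/4 * (?D ((\<lambda>_. mat 1)(?p := e \<alpha>, ?q := e \<beta>)) h +
        ?D ((\<lambda>_. mat 1)(?q := e \<beta> ** e \<alpha>)) h + ?D ((\<lambda>_. mat 1)(?p := e \<alpha> ** e \<beta>)) h +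
        ?D ((\<lambda>_. mat 1)(?q := e \<alpha>, ?p := e \<beta>)) h))"
      by (simp only:)
    also have "\<dots> = 1/4 * ((W (flip i T) h - 1/2 * W T h) + 3/2 * W T h + 3/2 * W T h +
        (W (flip i T) h - 1/2 * W T h))"
      unfolding casimir_linear casimir_two[OF i tf(1)]
        casimir_two[OF i tf(2)] casimir_one[OF i] ..
    finally have c: "casimir ?I = 1/4 * ((W (flip i T) h - 1/2 * W T h) + 3/2 * W T h + 3/2 * W T h +
        (W (flip i T) h - 1/2 * W T h))" .
    \<comment> \<open>The bracket equals \<open>2 * W (flip i T) h + 2 * W T h\<close>; with 1/4 and
      the prefactor \<open>2 * eps i\<close> both coefficients become \<open>eps i\<close>.\<close>
    show ?thesis unfolding op c using True by (simp add: diag_coeff_def flip_coeff_def algebra_simps)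
  qed
qed

text \<open>The closure under binary combinations turns every identity that is linear in
  \<open>F\<close> into a check on the generators \<open>W T\<close>, by rule induction.\<close>

inductive_set wilson_span :: "2 arc_function set" where
  wilson: "W T \<in> wilson_span"
| lincomb: "F \<in> wilson_span \<Longrightarrow> G \<in> wilson_span \<Longrightarrow> (\<lambda>h. a * F h + b * G h) \<in> wilson_span"

abbreviation D :: "nat \<Rightarrow> 2 arc_function \<Rightarrow> 2 arc_function" where "D \<equiv> crossing_op L e"

lemma wilson_span_poly_functions: "F \<in> wilson_span \<Longrightarrow> F \<in> poly_functions (arcs L)"
  by (induction rule: wilson_span.induct)
    (auto intro: wilson_function_in_poly_functions poly_functions.add poly_functions_scale)

lemma D_linear:
  "F \<in> wilson_span \<Longrightarrow> G \<in> wilson_span \<Longrightarrow> D i (\<lambda>h. a * F h + b * G h) = (\<lambda>h. a * D i F h + b * D i G h)"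
  by (simp add: crossing_op_linear wilson_span_poly_functions)

lemma D_in_wilson_span:
  assumes "i \<in> crossings" "F \<in> wilson_span"
  shows "D i F \<in> wilson_span"
  using assms(2)
  by (induction rule: wilson_span.induct)
    (auto simp: crossing_op_wilson[OF assms(1)] D_linear intro!: wilson_span.intros)

text \<open>The mixed term cancels because the diagonal coefficient changes sign under
  \<open>flip i\<close>; the coefficient of \<open>W T\<close> that remains is 1 + 2.\<close>

lemma D_square:
  assumes i: "i \<in> crossings" and F: "F \<in> wilson_span"
  shows "D i (D i F) = (\<lambda>h. 3 * F h)"
  using F
proof (induction rule: wilson_span.induct)
  case (wilson T)
  have "D i (D i (W T)) = (\<lambda>h. (diag_coeff i T * diag_coeff i T +
      flip_coeff i T * flip_coeff i (flip i T)) * W T h)"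
    unfolding crossing_op_wilson[OF i] D_linear[OF wilson_span.wilson wilson_span.wilson]
    by (simp add: coeff_flip fun_eq_iff algebra_simps)
  then show ?case unfolding coeff_square .
next
  case (lincomb F G a b)
  then show ?case by (simp add: D_linear D_in_wilson_span[OF i] fun_eq_iff algebra_simps)
qed

text \<open>For \<open>i \<noteq> j\<close> the coefficients at \<open>i\<close> do not depend on
  whether \<open>j \<in> T\<close>, and the flips commute.\<close>

lemma D_commute:
  assumes i: "i \<in> crossings" and j: "j \<in> crossings" and F: "F \<in> wilson_span"
  shows "D i (D j F) = D j (D i F)"
proof (cases "i = j")
  case False
  show ?thesis using F
  proof (induction rule: wilson_span.induct)
    case (wilson T)
    show ?case using False
      unfolding crossing_op_wilson[OF i] crossing_op_wilson[OF j]
        D_linear[OF wilson_span.wilson wilson_span.wilson]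
      by (simp add: coeff_flip fun_eq_iff flip_commute[of i j] algebra_simps)
  next
    case (lincomb F G a b)
    then show ?case by (simp add: D_linear D_in_wilson_span[OF i] D_in_wilson_span[OF j])
  qed
qed simp

section \<open>Exponentials of the crossing operators on the span\<close>

abbreviation E :: "complex \<Rightarrow> nat \<Rightarrow> 2 arc_function \<Rightarrow> 2 arc_function" where
  "E \<beta> i \<equiv> exp_op \<beta> (D i)"

definition cosh3 :: "complex \<Rightarrow> complex" where
  "cosh3 \<beta> = cosh (of_real (sqrt 3) * \<beta>)"

definition sinh3 :: "complex \<Rightarrow> complex" where
  "sinh3 \<beta> = sinh (of_real (sqrt 3) * \<beta>) / of_real (sqrt 3)"

lemma E_eq:
  assumes i: "i \<in> crossings" and F: "F \<in> wilson_span"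
  shows "E \<beta> i F = (\<lambda>h. cosh3 \<beta> * F h + sinh3 \<beta> * D i F h)"
  unfolding cosh3_def sinh3_def
proof (rule exp_op_square)
  have "(complex_of_real (sqrt 3))\<^sup>2 = 3" by (simp flip: of_real_power)
  then show "D i (\<lambda>h. a * F h + b * D i F h) =
      (\<lambda>h. a * D i F h + b * ((complex_of_real (sqrt 3))\<^sup>2 * F h))" for a b
    by (simp add: D_linear F D_in_wilson_span[OF i F] D_square[OF i F])
qed simp

lemma E_in_wilson_span: "i \<in> crossings \<Longrightarrow> F \<in> wilson_span \<Longrightarrow> E \<beta> i F \<in> wilson_span"
  by (simp add: E_eq D_in_wilson_span wilson_span.lincomb)

lemma E_linear:
  assumes "i \<in> crossings" "F \<in> wilson_span" "G \<in> wilson_span"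
  shows "E \<beta> i (\<lambda>h. a * F h + b * G h) = (\<lambda>h. a * E \<beta> i F h + b * E \<beta> i G h)"
  using assms by (simp add: E_eq wilson_span.lincomb D_linear fun_eq_iff algebra_simps)

text \<open>Each exponential is a combination of the identity and one crossing operator, which
  reduces the claim to \<open>D_commute\<close>.\<close>

lemma E_commute:
  assumes i: "i \<in> crossings" and j: "j \<in> crossings" and F: "F \<in> wilson_span"
  shows "E \<beta> i (E \<beta> j F) = E \<beta> j (E \<beta> i F)"
proof -
  have "E \<beta> k (E \<beta> l F) = (\<lambda>h. cosh3 \<beta> * (cosh3 \<beta> * F h + sinh3 \<beta> * D l F h) +
      sinh3 \<beta> * (cosh3 \<beta> * D k F h + sinh3 \<beta> * D k (D l F) h))"
    if "k \<in> crossings" "l \<in> crossings" for k l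
    by (subst E_eq[OF that(1) E_in_wilson_span[OF that(2) F]])
      (simp only: E_eq[OF that(2) F] D_linear[OF F D_in_wilson_span[OF that(2) F]])
  from this[OF i j] this[OF j i] show ?thesis
    by (simp add: D_commute[OF i j F] algebra_simps)
qed

lemma exp_prod_in_wilson_span:
  "set js \<subseteq> crossings \<Longrightarrow> F \<in> wilson_span \<Longrightarrow> exp_prod L e \<beta> js F \<in> wilson_span"
  by (induction js) (auto simp: exp_prod_def intro!: E_in_wilson_span)

lemma exp_prod_linear:
  assumes "set js \<subseteq> crossings" "F \<in> wilson_span" "G \<in> wilson_span"
  shows "exp_prod L e \<beta> js (\<lambda>h. a * F h + b * G h) =
    (\<lambda>h. a * exp_prod L e \<beta> js F h + b * exp_prod L e \<beta> js G h)"
  using assms(1)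
proof (induction js)
  case (Cons j js)
  then show ?case
    using assms(2,3) exp_prod_in_wilson_span[of js F \<beta>] exp_prod_in_wilson_span[of js G \<beta>]
    by (simp add: exp_prod_def E_linear)
qed (simp add: exp_prod_def)

lemma E_exp_prod:
  assumes "set js \<subseteq> crossings" "i \<in> crossings" "F \<in> wilson_span"
  shows "E \<beta> i (exp_prod L e \<beta> js F) = exp_prod L e \<beta> js (E \<beta> i F)"
  using assms(1)
proof (induction js)
  case (Cons j js)
  then show ?case
    using assms(2,3) exp_prod_in_wilson_span[of js F \<beta>] E_commute[of i j "exp_prod L e \<beta> js F" \<beta>]
    by (simp add: exp_prod_def)
qed (simp add: exp_prod_def)

text \<open>The factor at \<open>i\<close> is commuted to the front past all factors before it;
  distinctness ensures that filtering deletes just this one occurrence.\<close>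

lemma exp_prod_extract:
  assumes "set js \<subseteq> crossings" "distinct js" "i \<in> set js" "F \<in> wilson_span"
  shows "exp_prod L e \<beta> js F = E \<beta> i (exp_prod L e \<beta> (filter (\<lambda>j. j \<noteq> i) js) F)"
  using assms(1-3)
proof (induction js)
  case (Cons j js)
  show ?case
  proof (cases "j = i")
    case True
    then have "filter (\<lambda>j. j \<noteq> i) js = js" using Cons.prems by (auto intro: filter_True)
    then show ?thesis using True by (simp add: exp_prod_def)
  next
    case False
    let ?G = "exp_prod L e \<beta> (filter (\<lambda>j. j \<noteq> i) js) F"
    have "?G \<in> wilson_span"
      using Cons.prems assms(4) by (intro exp_prod_in_wilson_span) auto
    moreover have "i \<in> crossings" "j \<in> crossings" using Cons.prems by auto
    ultimately have "E \<beta> j (E \<beta> i ?G) = E \<beta> i (E \<beta> j ?G)" by (intro E_commute)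
    then show ?thesis using False Cons by (simp add: exp_prod_def)
  qed
qed simp

text \<open>The exponential at \<open>i\<close> is moved inside the product, where
  \<open>D i\<close> acts directly on \<open>W T\<close>. As \<open>i \<notin> T\<close>, the
  coefficients are \<open>- eps i\<close> and \<open>2 * eps i\<close>.\<close>

lemma skein:
  assumes js: "set js \<subseteq> crossings" and i: "i \<in> crossings" "i \<notin> T"
  shows "E \<beta> i (exp_prod L e \<beta> js (W T)) =
    (\<lambda>h. (cosh3 \<beta> - eps i * sinh3 \<beta>) * exp_prod L e \<beta> js (W T) h +
         2 * eps i * sinh3 \<beta> * exp_prod L e \<beta> js (W (T \<union> {i})) h)"
proof -
  have "E \<beta> i (W T) = (\<lambda>h. (cosh3 \<beta> - eps i * sinh3 \<beta>) * W T h + 2 * eps i * sinh3 \<beta> * W (T \<union> {i}) h)"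
    using i by (simp add: E_eq wilson_span.wilson crossing_op_wilson diag_coeff_def flip_coeff_def
        flip_def algebra_simps)
  then show ?thesis
    unfolding E_exp_prod[OF js i(1) wilson_span.wilson]
    by (simp only: exp_prod_linear[OF js wilson_span.wilson wilson_span.wilson])
qed

end

theorem mainTheorem1:
  fixes L :: link
    and e :: "'b::finite \<Rightarrow> complex^2^2"
    and lam \<beta> :: complex
    and i :: nat and S :: "nat set"
    and D :: "nat \<Rightarrow> 2 arc_function \<Rightarrow> 2 arc_function"
    and Q :: "2 arc_function \<Rightarrow> 2 arc_function"
    and W :: "nat set \<Rightarrow> 2 arc_function"
  assumes "link_in_general_position L"
    and "inj e" and "independent (range e)" and "span (range e) = su"
    and "lam \<noteq> 0" and "\<beta> = 1 / (2 * lam)"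
    and "i \<in> {1..ncross L}" and "S \<subseteq> {1..ncross L} - {i}"
    and "D = crossing_op L e"
    and "Q = exp_prod L e \<beta> (filter (\<lambda>j. j \<noteq> i) [1..<Suc (ncross L)])"
    and "W = wilson_function L"
  shows "(crossing_sign L i = 1 \<longrightarrow>
            exp_op \<beta> (D i) (Q (W S)) =
              (\<lambda>h. (cosh (of_real (sqrt 3) * \<beta>) - 1 / of_real (sqrt 3) * sinh (of_real (sqrt 3) * \<beta>))
                      * Q (W S) h
                   + 2 / of_real (sqrt 3) * sinh (of_real (sqrt 3) * \<beta>) * Q (W (S \<union> {i})) h)) \<and>
         (crossing_sign L i = - 1 \<longrightarrow>
            exp_op \<beta> (D i) (Q (W S)) =
              (\<lambda>h. (cosh (of_real (sqrt 3) * \<beta>) + 1 / of_real (sqrt 3) * sinh (of_real (sqrt 3) * \<beta>))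
                      * Q (W S) h
                   - 2 / of_real (sqrt 3) * sinh (of_real (sqrt 3) * \<beta>) * Q (W (S \<union> {i})) h)) \<and>
         exp_op \<beta> (D i) (Q (W {})) = link_expectation L e lam \<and>
         (\<forall>A. background_connection su A \<longrightarrow>
            exp_op \<beta> (D i) (Q (W {})) (arc_holonomy L A) =
              link_expectation L e lam (arc_holonomy L A))"
proof -
  interpret generic_link L by unfold_locales (rule assms(1))
  interpret fierz_link L e by unfold_locales (rule fierz_su2[OF assms(2-4)])
  let ?js = "filter (\<lambda>j. j \<noteq> i) [1..<Suc (ncross L)]"
  have js: "set ?js \<subseteq> crossings" by auto
  have "i \<notin> S" using assms(8) by blast
  note skein = skein[OF js assms(7) this, of \<beta>]
  \<comment> \<open>Putting the factor at \<open>i\<close> back into its place in the ordered list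
    restores the complete product. Evaluation at \<open>arc_holonomy L A\<close> then gives the
    statement for a background connection.\<close>
  have "exp_op \<beta> (D i) (Q (W {})) = link_expectation L e lam"
    unfolding link_expectation_def assms(9-11) assms(6)[symmetric]
    using assms(7) by (intro exp_prod_extract[symmetric] wilson_span.wilson) auto
  \<comment> \<open>A crossing sign of 1 or -1 means a strictly positive or negative height
    difference, and there \<open>2 * step\<close> agrees with \<open>sgn\<close>.\<close>
  moreover have "eps i = 1" if "crossing_sign L i = 1"
    using that by (auto simp: crossing_sign_def eps_def step_def sgn_if split: if_splits)
  moreover have "eps i = - 1" if "crossing_sign L i = - 1"
    using that by (auto simp: crossing_sign_def eps_def step_def sgn_if split: if_splits)
  ultimately show ?thesis using skein by (simp add: assms(9-11) cosh3_def sinh3_def)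
qed

end
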